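(* For all integers $n,k\ge 1$, $$m^{\mathrm{odd}}_k(n)\ \le\ \sqrt{32}\,\sqrt{k}\,n.$$
   Context: All graphs are simple. A drawing of a graph in the plane represents vertices by distinct points and edges by curves joining the points of their endpoints, such that no edge passes through a vertex other than its endpoints, no two edges touch (every common interior point is a proper crossing), no three edges cross at a common point, and any two edges cross finitely many times. A graph is $k$-odd-planar if it has a drawing in which every edge is crossed an odd number of times by at most $k$ other edges (edges crossing it an even number of times are not counted); $m^{\mathrm{odd}}_k(n)$ denotes the maximum number of edges of a $k$-odd-planar graph on $n$ vertices. *)

theory Defs
  imports "HOL-Analysis.Analysis"
begin

definition simple_graph :: "'a set \<Rightarrow> 'a set set \<Rightarrow> bool" where
  "simple_graph V E \<longleftrightarrow> finite V \<and> (\<forall>e\<in>E. e \<subseteq> V \<and> card e = 2)"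

definition curve_interior :: "(real \<Rightarrow> complex) \<Rightarrow> complex set" where
  "curve_interior g = g ` {0<..<1}"

text \<open>The common interior points of two curves; in a drawing these are exactly their crossings.\<close>

definition crossings :: "(real \<Rightarrow> complex) \<Rightarrow> (real \<Rightarrow> complex) \<Rightarrow> complex set" where
  "crossings g h = curve_interior g \<inter> curve_interior h"

text \<open>
  A crossing is proper if, up to a homeomorphism of a neighbourhood of the point, the two curves
  are the two coordinate axes of a disc; this rules out touchings.  Edges are not required to be
  injective (self-intersections away from the other edges are harmless), so it is demanded that
  each curve passes through the crossing only once.  Together with the local condition on the
  images this forces each curve to pass from one side of the other curve to the opposite side.
\<close>

definition proper_crossing :: "(real \<Rightarrow> complex) \<Rightarrow> (real \<Rightarrow> complex) \<Rightarrow> complex \<Rightarrow> bool" where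
  "proper_crossing g h p \<longleftrightarrow>
     (\<exists>!s. s \<in> {0..1} \<and> g s = p) \<and> (\<exists>!t. t \<in> {0..1} \<and> h t = p) \<and>
     (\<exists>U \<phi> \<psi>. open U \<and> p \<in> U \<and> homeomorphism U (ball 0 1) \<phi> \<psi> \<and> \<phi> p = 0 \<and>
        \<phi> ` (path_image g \<inter> U) = {z \<in> ball 0 1. Im z = 0} \<and>
        \<phi> ` (path_image h \<inter> U) = {z \<in> ball 0 1. Re z = 0})"

text \<open>
  A drawing places vertex v at the point pos v and represents edge e by the curve c e,
  parametrised by the unit interval in either of the two directions.
\<close>

definition drawing ::
  "'a set \<Rightarrow> 'a set set \<Rightarrow> ('a \<Rightarrow> complex) \<Rightarrow> ('a set \<Rightarrow> real \<Rightarrow> complex) \<Rightarrow> bool" where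
  "drawing V E pos c \<longleftrightarrow>
     inj_on pos V \<and>
     (\<forall>e\<in>E. path (c e) \<and> {pathstart (c e), pathfinish (c e)} = pos ` e \<and>
            curve_interior (c e) \<inter> pos ` V = {}) \<and>
     (\<forall>e\<in>E. \<forall>f\<in>E. e \<noteq> f \<longrightarrow>
        finite (crossings (c e) (c f)) \<and>
        (\<forall>p \<in> crossings (c e) (c f). proper_crossing (c e) (c f) p)) \<and>
     (\<forall>e\<in>E. \<forall>f\<in>E. \<forall>g\<in>E. e \<noteq> f \<and> e \<noteq> g \<and> f \<noteq> g \<longrightarrow>
        curve_interior (c e) \<inter> curve_interior (c f) \<inter> curve_interior (c g) = {})"

definition k_odd_planar :: "nat \<Rightarrow> 'a set \<Rightarrow> 'a set set \<Rightarrow> bool" where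
  "k_odd_planar k V E \<longleftrightarrow>
     (\<exists>pos c. drawing V E pos c \<and>
        (\<forall>e\<in>E. card {f \<in> E. f \<noteq> e \<and> odd (card (crossings (c e) (c f)))} \<le> k))"

text \<open>
  Vertices are natural numbers without loss of generality; the lemmas below show that the maximum
  exists and bounds the number of edges of graphs with vertices of any type.
\<close>

definition m_odd :: "nat \<Rightarrow> nat \<Rightarrow> nat" where
  "m_odd k n = Max {card E | (V :: nat set) E. simple_graph V E \<and> card V = n \<and> k_odd_planar k V E}"

lemma simple_graph_card_le:
  assumes "simple_graph V E"
  shows "finite E" "card E \<le> 2 ^ card V"
proof -
  have "finite V" "E \<subseteq> Pow V" using assms by (auto simp: simple_graph_def)
  then show "finite E" "card E \<le> 2 ^ card V"
    by (auto intro: finite_subset simp: card_mono simp flip: card_Pow)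
qed

lemma m_odd_set:
  fixes k n :: nat
  defines "S \<equiv> {card E | (V :: nat set) E. simple_graph V E \<and> card V = n \<and> k_odd_planar k V E}"
  shows "finite S" "S \<noteq> {}"
proof -
  have "S \<subseteq> {..2 ^ n}" unfolding S_def using simple_graph_card_le(2) by auto
  then show "finite S" by (rule finite_subset) simp
  have "drawing {..<n} {} (of_nat :: nat \<Rightarrow> complex) (\<lambda>_ _. 0)"
    by (auto simp: drawing_def inj_on_def)
  then have "k_odd_planar k {..<n} {}" by (auto simp: k_odd_planar_def)
  moreover have "simple_graph {..<n} {}" by (simp add: simple_graph_def)
  ultimately have "card ({} :: nat set set) \<in> S" unfolding S_def
    by (intro CollectI exI[of _ "{..<n}"] exI[of _ "{}"]) auto
  then show "S \<noteq> {}" by blast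
qed

lemma card_edges_le_m_odd:
  fixes V :: "'a set"
  assumes G: "simple_graph V E" and n: "card V = n" and kop: "k_odd_planar k V E"
  shows "card E \<le> m_odd k n"
proof -
  have fin: "finite V" and sub: "\<And>e. e \<in> E \<Longrightarrow> e \<subseteq> V \<and> card e = 2"
    using G by (auto simp: simple_graph_def)
  obtain b :: "'a \<Rightarrow> nat" where b: "inj_on b V"
    using finite_imp_inj_to_nat_seg[OF fin] by blast
  define i where "i = inv_into V b"
  have ib: "i (b v) = v" if "v \<in> V" for v using that b by (simp add: i_def)
  have ibi: "i ` b ` e = e" if "e \<subseteq> V" for e using that ib by force
  define F where "F = (`) b ` E"
  have injE: "inj_on ((`) b) E" using sub ibi by (metis inj_onI)
  obtain pos c where d: "drawing V E pos c"
    and k: "\<And>e. e \<in> E \<Longrightarrow> card {f \<in> E. f \<noteq> e \<and> odd (card (crossings (c e) (c f)))} \<le> k"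
    using kop by (auto simp: k_odd_planar_def)
  define pos' where "pos' = pos \<circ> i"
  define c' where "c' = (\<lambda>e. c (i ` e))"
  have c': "c' (b ` e) = c e" if "e \<in> E" for e using ibi sub that by (simp add: c'_def)
  have pos': "pos' ` b ` e = pos ` e" if "e \<subseteq> V" for e
    using ibi[OF that] unfolding pos'_def by (metis image_comp)
  have "inj_on pos' (b ` V)"
    using d ib by (auto simp: drawing_def pos'_def inj_on_def)
  moreover have "b ` e = b ` f \<longleftrightarrow> e = f" if "e \<in> E" "f \<in> E" for e f
    using injE that by (auto dest: inj_onD)
  ultimately have "drawing (b ` V) F pos' c'"
    using d sub unfolding drawing_def F_def by (simp add: c' pos')
  moreover have "card {f \<in> F. f \<noteq> b ` e \<and> odd (card (crossings (c' (b ` e)) (c' f)))} \<le> k"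
    if e: "e \<in> E" for e
  proof -
    have "{f \<in> F. f \<noteq> b ` e \<and> odd (card (crossings (c' (b ` e)) (c' f)))}
        \<subseteq> (`) b ` {f \<in> E. f \<noteq> e \<and> odd (card (crossings (c e) (c f)))}"
      (is "?A \<subseteq> (`) b ` ?B")
    proof
      fix f assume "f \<in> ?A"
      then obtain f' where f': "f' \<in> E" "f = b ` f'" "f' \<noteq> e"
        "odd (card (crossings (c' (b ` e)) (c' (b ` f'))))" by (auto simp: F_def)
      then have "f' \<in> ?B" using c' e by simp
      then show "f \<in> (`) b ` ?B" using f'(2) by (rule rev_image_eqI)
    qed
    moreover have "finite ?B" using simple_graph_card_le(1)[OF G] by simp
    ultimately have "card ?A \<le> card ?B" by (rule surj_card_le[rotated])
    then show ?thesis using k[OF e] by linarith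
  qed
  ultimately have "k_odd_planar k (b ` V) F"
    unfolding k_odd_planar_def by (intro exI[of _ pos'] exI[of _ c']) (simp add: F_def)
  moreover have "simple_graph (b ` V) F"
    using fin sub b by (auto simp: simple_graph_def F_def card_image inj_on_subset)
  moreover have "card (b ` V) = n" using b n by (simp add: card_image)
  moreover have "card F = card E" using injE by (simp add: F_def card_image)
  ultimately have "card E \<in> {card E | (V :: nat set) E.
      simple_graph V E \<and> card V = n \<and> k_odd_planar k V E}"
    by (intro CollectI exI[of _ "b ` V"] exI[of _ F]) simp
  then show ?thesis unfolding m_odd_def by (rule Max_ge[OF m_odd_set(1)])
qed

end

theory Submission
  imports Defs "HOL-Complex_Analysis.Winding_Numbers"
begin

text \<open>
  For curves g, h with the endpoints of each off the other, the map (s, t) \<mapsto> g s - h t does not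
  vanish on the boundary of the unit square; its winding number there is an integer that is additive
  under concatenation of curves and has the parity of the number of proper crossings.

  For five points joined pairwise by curves, the sum of these integers over the 15 pairs of
  disjoint edges of K5 is odd (van Kampen), whatever adjacent edges do. The property
  ``disjoint edges have even intersection number'' survives the contraction of an edge uv, because the
  new edge uw can be drawn along uv and vw. Mader's argument therefore applies: a graph with at least
  3n - 1 edges can be reduced by deletions and contractions to one containing K5. Hence a graph all of
  whose disjoint edges cross evenly has at most 3n edges, any graph has at least m - 3n disjoint pairs
  crossing oddly, and sampling vertices with probability 4n/m yields at least m^3/(64 n^2) such pairs.
  In a k-odd-planar graph there are at most km/2 of them.
\<close>

section \<open>Intersection numbers of curves\<close>

text \<open>Contraction shapes the proof. The curves it produces overlap adjacent ones and may run
  through the same stretch several times, so they form no \<open>drawing\<close> and their crossings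
  cannot be counted. Hence the invariant is defined for continuous curves in general, and crossings
  are counted only once, in the original drawing. The 3 in 3n comes from contraction: if the ends of
  an edge have at most two common neighbours, contracting it loses one vertex and at most three
  edges. Sampling with probability t n/m gives (t - 3)/t^3 times m^3/n^2 odd pairs; t = 4 gives
  1/64. Comparing m^3/(64 n^2) with km/2 yields m^2 \<le> 32 k n^2, and graphs with m < 4n, to which
  sampling does not apply, lie below this bound anyway.\<close>

definition off_ends :: "(real \<Rightarrow> complex) \<Rightarrow> (real \<Rightarrow> complex) \<Rightarrow> bool" where
  "off_ends g h \<longleftrightarrow> path g \<and> path h \<and>
     pathstart g \<notin> path_image h \<and> pathfinish g \<notin> path_image h \<and>
     pathstart h \<notin> path_image g \<and> pathfinish h \<notin> path_image g"

text \<open>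
  The terms are the changes of arg (g s - h t) / (2 pi) along the four sides of the unit square; on the
  vertical sides arg (g s - h t) and arg (h t - g s) differ by a constant.
\<close>

definition turning :: "(real \<Rightarrow> complex) \<Rightarrow> (real \<Rightarrow> complex) \<Rightarrow> complex" where
  "turning g h = winding_number g (pathstart h) - winding_number g (pathfinish h)
     + winding_number h (pathfinish g) - winding_number h (pathstart g)"

text \<open>The floor only turns the complex value of \<open>turning\<close> into an integer. It is
  exact under \<open>off_ends\<close> and carries no meaning for other pairs of curves.\<close>

definition inum :: "(real \<Rightarrow> complex) \<Rightarrow> (real \<Rightarrow> complex) \<Rightarrow> int" where
  "inum g h = \<lfloor>Re (turning g h)\<rfloor>"

lemma exp_winding_number:
  assumes "path p" "z \<notin> path_image p"
  shows "exp (2 * of_real pi * \<i> * winding_number p z) = (pathfinish p - z) / (pathstart p - z)"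
  proof -
  have "pathstart p - z \<noteq> 0" using assms by (metis eq_iff_diff_eq_0 pathstart_in_path_image)
  then show ?thesis using winding_number_exp_2pi[OF assms] by (simp add: eq_divide_eq)
qed

lemma exp_2pi_eq_1_imp_Ints:
  assumes "exp (2 * of_real pi * \<i> * w) = 1"
  shows "w \<in> \<int>"
proof -
  obtain n :: int where "2 * of_real pi * \<i> * w = of_int (2 * n) * pi * \<i>"
    using assms exp_eq[of "2 * of_real pi * \<i> * w" 0] by auto
  then have "w = of_int n" by auto
  then show ?thesis by simp
qed

lemma off_ends_endpoints:
  assumes "off_ends g h"
  shows "pathstart g \<noteq> pathstart h" "pathstart g \<noteq> pathfinish h"
    "pathfinish g \<noteq> pathstart h" "pathfinish g \<noteq> pathfinish h"
  using assms by (metis off_ends_def pathstart_in_path_image pathfinish_in_path_image)+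

text \<open>Multiplied by 2 pi i and exponentiated, each winding number becomes a quotient of
  endpoint differences. Around the square each corner difference occurs once above and once below,
  up to signs that cancel as well.\<close>

lemma of_int_inum:
  assumes "off_ends g h"
  shows "of_int (inum g h) = turning g h"
proof -
  have e: "exp (2 * of_real pi * \<i> * winding_number g (pathstart h)) =
      (pathfinish g - pathstart h) / (pathstart g - pathstart h)"
    "exp (2 * of_real pi * \<i> * winding_number g (pathfinish h)) =
      (pathfinish g - pathfinish h) / (pathstart g - pathfinish h)"
    "exp (2 * of_real pi * \<i> * winding_number h (pathfinish g)) =
      (pathfinish h - pathfinish g) / (pathstart h - pathfinish g)"
    "exp (2 * of_real pi * \<i> * winding_number h (pathstart g)) =
      (pathfinish h - pathstart g) / (pathstart h - pathstart g)"
    using assms by (auto simp: off_ends_def intro!: exp_winding_number)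
  have "exp (2 * of_real pi * \<i> * turning g h) =
     exp (2 * of_real pi * \<i> * winding_number g (pathstart h)) / exp (2 * of_real pi * \<i> * winding_number g (pathfinish h)) *
     exp (2 * of_real pi * \<i> * winding_number h (pathfinish g)) / exp (2 * of_real pi * \<i> * winding_number h (pathstart g))"
    unfolding turning_def by (simp add: algebra_simps exp_add exp_diff)
  also have "\<dots> = 1"
    unfolding e using off_ends_endpoints[OF assms]
    by (simp add: divide_simps) (simp add: algebra_simps)
  finally have "turning g h \<in> \<int>" by (rule exp_2pi_eq_1_imp_Ints)
  then show ?thesis by (auto simp: inum_def elim!: Ints_cases)
qed

lemma off_ends_commute: "off_ends g h \<Longrightarrow> off_ends h g"
  by (auto simp: off_ends_def)

lemma inum_commute:
  assumes "off_ends g h"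
  shows "inum h g = - inum g h"
proof -
  have "of_int (inum h g) = (of_int (- inum g h) :: complex)"
    using of_int_inum[OF assms] of_int_inum[OF off_ends_commute[OF assms]] by (simp add: turning_def)
  then show ?thesis by (simp only: of_int_eq_iff)
qed

lemma off_ends_reversepath: "off_ends g h \<Longrightarrow> off_ends (reversepath g) h"
  by (auto simp: off_ends_def)

lemma inum_reversepath:
  assumes "off_ends g h"
  shows "inum (reversepath g) h = - inum g h"
proof -
  have "of_int (inum (reversepath g) h) = (of_int (- inum g h) :: complex)"
    using of_int_inum[OF assms] of_int_inum[OF off_ends_reversepath[OF assms]] assms
    by (simp add: turning_def off_ends_def winding_number_reversepath)
  then show ?thesis by (simp only: of_int_eq_iff)
qed

text \<open>The winding numbers of \<open>h\<close> around the common endpoint cancel; those of the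
  joined curve add up.\<close>

lemma inum_join:
  assumes "off_ends g h" "off_ends g' h" "pathfinish g = pathstart g'"
  shows "off_ends (g +++ g') h" "inum (g +++ g') h = inum g h + inum g' h"
proof -
  show o: "off_ends (g +++ g') h" using assms by (auto simp: off_ends_def path_image_join)
  have "of_int (inum (g +++ g') h) = (of_int (inum g h + inum g' h) :: complex)"
    using of_int_inum[OF o] of_int_inum[OF assms(1)] of_int_inum[OF assms(2)] assms
    by (simp add: turning_def off_ends_def winding_number_join)
  then show "inum (g +++ g') h = inum g h + inum g' h" by (simp only: of_int_eq_iff)
qed

lemma inum_subpath_split:
  assumes p: "path g" "path h" and u: "u \<in> {0..1}" "v \<in> {0..1}" "w \<in> {0..1}" "u \<le> v" "v \<le> w"
    and h: "pathstart h \<notin> g ` {u..w}" "pathfinish h \<notin> g ` {u..w}"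
    and g: "g u \<notin> path_image h" "g v \<notin> path_image h" "g w \<notin> path_image h"
  shows "inum (subpath u w g) h = inum (subpath u v g) h + inum (subpath v w g) h"
proof -
  have o: "off_ends (subpath u v g) h" "off_ends (subpath v w g) h" "off_ends (subpath u w g) h"
    using assms by (auto simp: off_ends_def path_image_subpath)
  have "winding_number (subpath u w g) z = winding_number (subpath u v g) z + winding_number (subpath v w g) z"
    if z: "z \<notin> g ` {u..w}" for z
  proof (cases "u = w")
    case True
    then show ?thesis using u z by auto
  next
    case False
    \<comment> \<open>\<open>z\<close> may lie on \<open>g\<close> at times outside
      \<open>{u..w}\<close>, so the split is made inside \<open>subpath u w g\<close>, where
      \<open>r\<close> is the relative position of \<open>v\<close>.\<close>
    define r where "r = (v - u) / (w - u)"
    have r: "r \<in> {0..1}" "v = u + (w - u) * r" using False u by (auto simp: r_def field_simps)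
    have "subpath 0 r (subpath u w g) = subpath u v g" "subpath r 1 (subpath u w g) = subpath v w g"
      by (auto simp: subpath_def fun_eq_iff r(2) algebra_simps)
    then show ?thesis
      using winding_number_subpath_combine[of "subpath u w g" z 0 r 1] z r u p
      by (simp add: path_image_subpath)
  qed
  then have "of_int (inum (subpath u w g) h) = (of_int (inum (subpath u v g) h + inum (subpath v w g) h) :: complex)"
    using h of_int_inum[OF o(1)] of_int_inum[OF o(2)] of_int_inum[OF o(3)]
    by (simp add: turning_def)
  then show ?thesis by (simp only: of_int_eq_iff)
qed

lemma winding_number_continuous_log:
  assumes "continuous_on {0..1} l" "\<And>t. t \<in> {0..1} \<Longrightarrow> p t - z = exp (l t)"
  shows "winding_number p z = (l 1 - l 0) / (2 * of_real pi * \<i>)"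
proof -
  have "winding_number p z = winding_number (\<lambda>t. p t - z) 0"
    by (rule winding_number_offset)
  also have "\<dots> = winding_number (exp \<circ> l) 0"
    by (rule winding_number_cong) (simp add: assms(2))
  also have "\<dots> = (l 1 - l 0) / (2 * of_real pi * \<i>)"
    using winding_number_compose_exp[of l] assms(1) by (simp add: path_def pathstart_def pathfinish_def)
  finally show ?thesis .
qed

lemma exp_add_ii_pi: "exp (z + \<i> * pi) = - exp z"
  by (simp add: exp_add)

text \<open>Here g s - h t vanishes nowhere on the contractible square, so it has one continuous
  logarithm there, whose increments along the four sides sum to 0. On the vertical sides the
  difference changes sign, which shifts the logarithm by a constant and leaves its increments
  alone.\<close>

lemma inum_disjoint:
  assumes "path g" "path h" and dis: "path_image g \<inter> path_image h = {}"
  shows "inum g h = 0"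
proof -
  let ?S = "{0..1::real} \<times> {0..1::real}"
  have "continuous_on ?S (\<lambda>x. g (fst x) - h (snd x))"
    using assms(1,2) unfolding path_def
    by (auto intro!: continuous_intros continuous_on_compose2[where f = fst] continuous_on_compose2[where f = snd])
  moreover have "contractible ?S" by (intro convex_imp_contractible convex_Times) auto
  moreover have "g (fst x) - h (snd x) \<noteq> 0" if "x \<in> ?S" for x
    using that dis by (auto simp: path_image_def)
  ultimately obtain L where L: "continuous_on ?S L" "\<And>x. x \<in> ?S \<Longrightarrow> g (fst x) - h (snd x) = exp (L x)"
    using continuous_logarithm_on_contractible by blast
  have 1: "winding_number g (h t) = (L (1, t) - L (0, t)) / (2 * of_real pi * \<i>)" if "t \<in> {0..1}" for t
    using that L by (intro winding_number_continuous_log) (auto intro!: continuous_intros continuous_on_compose2[OF L(1)] simp flip: L(2))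
  have 2: "winding_number h (g s) = (L (s, 1) - L (s, 0)) / (2 * of_real pi * \<i>)" if "s \<in> {0..1}" for s
  proof -
    have "continuous_on {0..1} (\<lambda>t. L (s, t) + \<i> * pi)"
      using that by (auto intro!: continuous_intros continuous_on_compose2[OF L(1)])
    moreover have "h t - g s = exp (L (s, t) + \<i> * pi)" if "t \<in> {0..1}" for t
      unfolding exp_add_ii_pi using that \<open>s \<in> {0..1}\<close> by (simp flip: L(2))
    ultimately show ?thesis by (subst winding_number_continuous_log[of "\<lambda>t. L (s, t) + \<i> * pi"]) auto
  qed
  have "off_ends g h" using assms unfolding off_ends_def by (auto dest: equals0D)
  moreover have "turning g h = 0"
    by (simp add: turning_def pathstart_def pathfinish_def 1 2 field_simps)
  ultimately have "of_int (inum g h) = (0::complex)" by (simp only: of_int_inum)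
  then show ?thesis by simp
qed

section \<open>Local intersection number at a proper crossing\<close>

lemma winding_number_uminus:
  assumes "path p" "0 \<notin> path_image p"
  shows "winding_number (\<lambda>t. - p t) 0 = winding_number p 0"
proof -
  obtain l where l: "continuous_on {0..1::real} l" "\<And>t. t \<in> {0..1} \<Longrightarrow> p t = exp (l t)"
    using continuous_logarithm_on_contractible[of "{0..1::real}" p] assms
    unfolding path_def path_image_def by (metis convex_imp_contractible convex_real_interval(5) image_eqI)
  have "continuous_on {0..1} (\<lambda>t. l t + \<i> * pi)" using l(1) by (intro continuous_intros)
  then have "winding_number (\<lambda>t. - p t) 0 = (l 1 - l 0) / (2 * of_real pi * \<i>)"
    using winding_number_continuous_log[of "\<lambda>t. l t + \<i> * pi" "\<lambda>t. - p t" 0] l(2)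
    by (simp add: exp_add)
  also have "\<dots> = winding_number p 0"
    using winding_number_continuous_log[of l p 0] l by simp
  finally show ?thesis .
qed

lemma winding_number_minus_left:
  assumes "path p" "z \<notin> path_image p"
  shows "winding_number (\<lambda>t. z - p t) 0 = winding_number p z"
proof -
  have "path (\<lambda>t. p t - z)" using assms unfolding path_def by (intro continuous_intros)
  then have "winding_number (\<lambda>t. - (p t - z)) 0 = winding_number (\<lambda>t. p t - z) 0"
    using assms by (intro winding_number_uminus) (auto simp: path_image_def)
  then show ?thesis using winding_number_offset[of p z] by simp
qed

text \<open>An odd loop has odd degree: the winding number w of the first half satisfies exp (2 pi i
  w) = -1, so w is half an odd integer, and the second half, its reflection in 0, contributes w
  again.\<close>

lemma winding_number_odd_loop:
  assumes "path p" "0 \<notin> path_image p" "pathfinish p = - pathstart p"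
  shows "\<exists>m. odd m \<and> winding_number (p +++ (\<lambda>t. - p t)) 0 = of_int m"
proof -
  let ?w = "winding_number p 0"
  have p': "path (\<lambda>t. - p t)" "0 \<notin> path_image (\<lambda>t. - p t)"
    using assms by (auto simp: path_def path_image_def intro: continuous_intros)
  have "winding_number (p +++ (\<lambda>t. - p t)) 0 = ?w + winding_number (\<lambda>t. - p t) 0"
    using assms p' by (intro winding_number_join) (auto simp: pathstart_def)
  then have 2: "winding_number (p +++ (\<lambda>t. - p t)) 0 = 2 * ?w"
    using winding_number_uminus assms by simp
  have "pathstart p \<noteq> 0" using assms by (metis pathstart_in_path_image)
  then have "exp (2 * of_real pi * \<i> * ?w) = -1"
    using exp_winding_number[OF assms(1,2)] assms(3) by simp
  then have "exp (2 * of_real pi * \<i> * ?w) = exp (\<i> * pi)" by simp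
  then obtain n :: int where n: "2 * of_real pi * \<i> * ?w = \<i> * pi + of_int (2 * n) * pi * \<i>"
    unfolding exp_eq by auto
  have "(of_real pi * \<i>) * (2 * ?w) = (of_real pi * \<i>) * of_int (2 * n + 1)"
    using n by (simp add: algebra_simps)
  then have "2 * ?w = of_int (2 * n + 1)"
    using mult_left_cancel[of "of_real pi * \<i>"] by (metis complex_i_not_zero no_zero_divisors of_real_eq_0_iff pi_neq_zero)
  then show ?thesis using 2 by (intro exI[of _ "2 * n + 1"]) simp
qed

lemma off_ends_axes:
  fixes \<psi> :: "complex \<Rightarrow> complex"
  assumes cont: "continuous_on (ball 0 1) \<psi>" and inj: "inj_on \<psi> (ball 0 1)" and r: "0 < r" "r < 1"
  shows "off_ends (\<psi> \<circ> linepath (- of_real r) (of_real r)) (\<psi> \<circ> linepath (- of_real r * \<i>) (of_real r * \<i>))"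
    (is "off_ends ?g ?h")
proof -
  have mid: "\<bar>r * (2 * t - 1)\<bar> \<le> r" if "t \<in> {0..1}" for t
    using that r mult_left_le[of "\<bar>2 * t - 1\<bar>" r] by (auto simp: abs_mult abs_le_iff)
  have i1: "linepath (- complex_of_real r) (complex_of_real r) t \<in> ball 0 1 \<and> Im (linepath (- complex_of_real r) (complex_of_real r) t) = 0" if "t \<in> {0..1}" for t
  proof -
    have "linepath (- complex_of_real r) (complex_of_real r) t = of_real (r * (2 * t - 1))"
      by (simp add: linepath_def complex_eq_iff algebra_simps)
    then show ?thesis using mid[OF that] r by (simp only: mem_ball_0 norm_of_real) auto
  qed
  have i2: "linepath (- complex_of_real r * \<i>) (complex_of_real r * \<i>) t \<in> ball 0 1 \<and> Re (linepath (- complex_of_real r * \<i>) (complex_of_real r * \<i>) t) = 0" if "t \<in> {0..1}" for t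
  proof -
    have "linepath (- complex_of_real r * \<i>) (complex_of_real r * \<i>) t = of_real (r * (2 * t - 1)) * \<i>"
      by (simp add: linepath_def complex_eq_iff algebra_simps)
    then show ?thesis using mid[OF that] r by (simp only: mem_ball_0 norm_of_real norm_mult) auto
  qed
  have "path ?g" "path ?h"
    using i1 i2 by (auto simp: path_image_def intro!: path_continuous_image continuous_on_subset[OF cont])
  moreover have "\<psi> z \<notin> path_image ?h" if "z \<in> ball 0 1" "Re z \<noteq> 0" for z
    using i2 that inj_onD[OF inj, of z] by (fastforce simp: path_image_def)
  moreover have "\<psi> z \<notin> path_image ?g" if "z \<in> ball 0 1" "Im z \<noteq> 0" for z
    using i1 that inj_onD[OF inj, of z] by (fastforce simp: path_image_def)
  ultimately show ?thesis using r by (simp add: off_ends_def pathstart_compose pathfinish_compose norm_mult)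
qed

text \<open>
  On the boundary of the square, write z = x + iy. The loop \<psi> x - \<psi> (- iy) is deformed through
  \<psi> a - \<psi> b with a - b = z, which never vanishes as \<psi> is injective, to the odd map
  \<psi> (z / 2) - \<psi> (- z / 2).
\<close>

lemma inum_axes_odd:
  fixes \<psi> :: "complex \<Rightarrow> complex"
  assumes cont: "continuous_on (ball 0 1) \<psi>" and inj: "inj_on \<psi> (ball 0 1)" and r: "0 < r" "r < 1"
  shows "odd (inum (\<psi> \<circ> linepath (- of_real r) (of_real r)) (\<psi> \<circ> linepath (- of_real r * \<i>) (of_real r * \<i>)))"
    (is "odd (inum ?g ?h)")
proof -
  define Q where "Q = {z. \<bar>Re z\<bar> \<le> r \<and> \<bar>Im z\<bar> \<le> r \<and> (\<bar>Re z\<bar> = r \<or> \<bar>Im z\<bar> = r)}"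
  \<comment> \<open>Two adjacent sides of the square, from the lower left to the upper right corner;
    their reflection in 0 is the rest of the boundary, as \<open>winding_number_odd_loop\<close>
    requires.\<close>
  define half where "half = linepath (Complex (-r) (-r)) (Complex r (-r)) +++ linepath (Complex r (-r)) (Complex r r)"
  define \<beta> where "\<beta> = half +++ (\<lambda>t. - half t)"
  define a where "a = (\<lambda>\<tau> z. of_real (1 - \<tau>) * of_real (Re z) + of_real \<tau> * z / 2)"
  define b where "b = (\<lambda>\<tau> z. a \<tau> z - z)"
  define K where "K = (\<lambda>\<tau> z. \<psi> (a \<tau> z) - \<psi> (b \<tau> z))"
  have mid: "\<bar>r * (2 * t - 1)\<bar> \<le> r" if "t \<in> {0..1}" for t
    using that r mult_left_le[of "\<bar>2 * t - 1\<bar>" r] by (auto simp: abs_mult abs_le_iff)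
  have half: "path half" "path_image half \<subseteq> Q" "pathstart half = Complex (-r) (-r)" "pathfinish half = Complex r r"
  proof -
    have "path_image (linepath (Complex (-r) (-r)) (Complex r (-r))) \<subseteq> Q"
      using mid r by (auto simp: Q_def path_image_def linepath_def algebra_simps)
    moreover have "path_image (linepath (Complex r (-r)) (Complex r r)) \<subseteq> Q"
      using mid r by (auto simp: Q_def path_image_def linepath_def algebra_simps)
    ultimately show "path_image half \<subseteq> Q" unfolding half_def by (auto simp: path_image_join)
  qed (auto simp: half_def)
  have nhalf: "path (\<lambda>t. - half t)" "pathstart (\<lambda>t. - half t) = Complex r r"
      "pathfinish (\<lambda>t. - half t) = Complex (-r) (-r)"
    using half(1,3,4) by (auto simp: path_def pathstart_def pathfinish_def complex_eq_iff intro: continuous_intros)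
  have "path_image (\<lambda>t. - half t) \<subseteq> Q"
    using half(2) by (auto simp: path_image_def Q_def)
  then have \<beta>: "path \<beta>" "path_image \<beta> \<subseteq> Q" "pathfinish \<beta> = pathstart \<beta>"
    using half nhalf by (auto simp: \<beta>_def path_image_join)
  \<comment> \<open>Both ends of each deformation segment have norm at most r: a coordinate of z by
    the choice of \<open>Q\<close>, and z/2 because the norm of z is at most the sum of its two
    coordinates in absolute value.\<close>
  have ab: "a \<tau> z \<in> ball 0 1" "b \<tau> z \<in> ball 0 1" if "\<tau> \<in> {0..1}" "z \<in> Q" for \<tau> z
  proof -
    have z: "norm z / 2 \<le> r" using that cmod_le[of z] by (auto simp: Q_def)
    have c: "(1 - \<tau>) * x + \<tau> * y \<le> r" if "x \<le> r" "y \<le> r" for x y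
      using convex_bound_le[of x r y "1 - \<tau>" \<tau>] that \<open>\<tau> \<in> {0..1}\<close> by auto
    have "norm (a \<tau> z) \<le> (1 - \<tau>) * \<bar>Re z\<bar> + \<tau> * (norm z / 2)"
      unfolding a_def using that by (intro norm_triangle_le) (auto simp: norm_mult norm_divide simp del: of_real_diff)
    also have "\<dots> \<le> r" using that z by (intro c) (auto simp: Q_def)
    finally show "a \<tau> z \<in> ball 0 1" using r by simp
    have beq: "b \<tau> z = - (of_real (1 - \<tau>) * (\<i> * of_real (Im z)) + of_real \<tau> * (z / 2))"
      unfolding a_def b_def by (simp add: complex_eq_iff algebra_simps)
    have "norm (b \<tau> z) = norm (of_real (1 - \<tau>) * (\<i> * of_real (Im z)) + of_real \<tau> * (z / 2))"
      unfolding beq by (rule norm_minus_cancel)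
    also have "\<dots> \<le> (1 - \<tau>) * \<bar>Im z\<bar> + \<tau> * (norm z / 2)"
      using that by (intro norm_triangle_le) (auto simp: norm_mult norm_divide simp del: of_real_diff)
    also have "\<dots> \<le> r" using that z by (intro c) (auto simp: Q_def)
    finally show "b \<tau> z \<in> ball 0 1" using r by simp
  qed
  have Q0: "z \<noteq> 0" if "z \<in> Q" for z using that r by (auto simp: Q_def)
  have K0: "K \<tau> z \<noteq> 0" if "\<tau> \<in> {0..1}" "z \<in> Q" for \<tau> z
  proof -
    have "a \<tau> z \<noteq> b \<tau> z" using Q0[OF that(2)] by (simp add: b_def)
    then show ?thesis using inj_onD[OF inj] ab[OF that] by (auto simp: K_def)
  qed
  have Kcont: "continuous_on ({0..1} \<times> Q) (\<lambda>x. K (fst x) (snd x))"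
    unfolding K_def
    by (intro continuous_intros continuous_on_compose2[OF cont])
       (use ab in \<open>auto simp: a_def b_def intro!: continuous_intros\<close>)
  have "homotopic_loops (- {0}) (K 0 \<circ> \<beta>) (K 1 \<circ> \<beta>)"
    unfolding homotopic_loops
  proof (intro exI[of _ "\<lambda>x. K (fst x) (\<beta> (snd x))"] conjI)
    have "continuous_on ({0..1} \<times> {0..1}) (\<lambda>x. (fst x, \<beta> (snd x)))"
      using \<beta>(1) unfolding path_def
      by (intro continuous_intros continuous_on_compose2[where f = snd and g = \<beta>]) auto
    from continuous_on_compose2[OF Kcont this]
    show "continuous_on ({0..1} \<times> {0..1}) (\<lambda>x. K (fst x) (\<beta> (snd x)))"
      using \<beta>(2) by (force simp: path_image_def)
  qed (use \<beta>(2,3) K0 in \<open>auto simp: path_image_def pathstart_def pathfinish_def image_subset_iff\<close>)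
  then have eq: "winding_number (K 0 \<circ> \<beta>) 0 = winding_number (K 1 \<circ> \<beta>) 0"
    by (rule winding_number_homotopic_loops)
  have Kpath: "path (K \<tau> \<circ> p)" "0 \<notin> path_image (K \<tau> \<circ> p)" if "\<tau> \<in> {0..1}" "path p" "path_image p \<subseteq> Q" for \<tau> p
  proof -
    have "continuous_on Q (K \<tau>)"
      using continuous_on_compose2[OF Kcont, of Q "\<lambda>z. (\<tau>, z)"] that(1)
      by (force intro!: continuous_intros)
    then show "path (K \<tau> \<circ> p)" using that by (auto intro: path_continuous_image continuous_on_subset)
    show "0 \<notin> path_image (K \<tau> \<circ> p)" using K0[OF that(1)] that(3) by (force simp: path_image_def)
  qed
  have K1: "K 1 (- z) = - K 1 z" for z by (simp add: K_def a_def b_def)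
  have "K 1 \<circ> \<beta> = (K 1 \<circ> half) +++ (\<lambda>t. - (K 1 \<circ> half) t)"
    unfolding \<beta>_def path_compose_join using K1 by (simp add: o_def)
  moreover have "\<exists>m. odd m \<and> winding_number ((K 1 \<circ> half) +++ (\<lambda>t. - (K 1 \<circ> half) t)) 0 = of_int m"
  proof (rule winding_number_odd_loop)
    have "Complex r r = - Complex (- r) (- r)" by (simp add: complex_eq_iff)
    then show "pathfinish (K 1 \<circ> half) = - pathstart (K 1 \<circ> half)"
      unfolding pathfinish_compose pathstart_compose half by (simp only: K1)
  qed (use half Kpath in auto)
  ultimately obtain m where m: "odd m" "winding_number (K 0 \<circ> \<beta>) 0 = of_int m"
    using eq by auto
  have K00: "K 0 z = \<psi> (of_real (Re z)) - \<psi> (- (\<i> * of_real (Im z)))" for z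
  proof -
    have "of_real (Re z) - z = - (\<i> * of_real (Im z))" by (simp add: complex_eq_iff)
    then show ?thesis by (simp add: K_def a_def b_def)
  qed
  have og: "off_ends ?g ?h" using off_ends_axes[OF assms] .
  \<comment> \<open>\<open>b 0 z\<close> is -i Im z, so moving up the square runs through
    \<open>?h\<close> backwards: the boundary is traversed with the orientation opposite to that of
    \<open>turning\<close>.\<close>
  have "winding_number (K 0 \<circ> \<beta>) 0 = - turning ?g ?h"
  proof -
    let ?p1 = "linepath (Complex (-r) (-r)) (Complex r (-r))"
    let ?p2 = "linepath (Complex r (-r)) (Complex r r)"
    have neg: "(\<lambda>t. - (p +++ q) t) = (\<lambda>t. - p t) +++ (\<lambda>t. - q t)" for p q :: "real \<Rightarrow> complex"
      by (auto simp: joinpaths_def)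
    have e1: "K 0 \<circ> ?p1 = (\<lambda>t. ?g t - pathfinish ?h)"
      by (simp add: K00 fun_eq_iff linepath_def scaleR_conv_of_real pathfinish_def algebra_simps)
    have e2: "K 0 \<circ> ?p2 = (\<lambda>t. pathfinish ?g - reversepath ?h t)"
      by (simp add: K00 fun_eq_iff linepath_def scaleR_conv_of_real pathfinish_def reversepath_def algebra_simps)
    have e3: "K 0 \<circ> (\<lambda>t. - ?p1 t) = (\<lambda>t. reversepath ?g t - pathstart ?h)"
      by (simp add: K00 fun_eq_iff linepath_def scaleR_conv_of_real pathstart_def reversepath_def algebra_simps)
    have e4: "K 0 \<circ> (\<lambda>t. - ?p2 t) = (\<lambda>t. pathstart ?g - ?h t)"
      by (simp add: K00 fun_eq_iff linepath_def scaleR_conv_of_real pathstart_def algebra_simps)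
    have w1: "winding_number (K 0 \<circ> ?p1) 0 = winding_number ?g (pathfinish ?h)"
      unfolding e1 by (rule winding_number_offset[symmetric])
    have w2: "winding_number (K 0 \<circ> ?p2) 0 = - winding_number ?h (pathfinish ?g)"
      unfolding e2 using og winding_number_minus_left[of "reversepath ?h" "pathfinish ?g"]
      by (simp add: off_ends_def winding_number_reversepath)
    have w3: "winding_number (K 0 \<circ> (\<lambda>t. - ?p1 t)) 0 = - winding_number ?g (pathstart ?h)"
      unfolding e3 using og by (simp add: off_ends_def winding_number_reversepath flip: winding_number_offset)
    have w4: "winding_number (K 0 \<circ> (\<lambda>t. - ?p2 t)) 0 = winding_number ?h (pathstart ?g)"
      unfolding e4 using og winding_number_minus_left[of ?h "pathstart ?g"] by (simp add: off_ends_def)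
    have pq: "path ?p1" "path_image ?p1 \<subseteq> Q" "path ?p2" "path_image ?p2 \<subseteq> Q"
      "path (\<lambda>t. - ?p1 t)" "path_image (\<lambda>t. - ?p1 t) \<subseteq> Q" "path (\<lambda>t. - ?p2 t)" "path_image (\<lambda>t. - ?p2 t) \<subseteq> Q"
    proof -
      show "path_image ?p1 \<subseteq> Q" "path_image ?p2 \<subseteq> Q"
        using half(2) by (auto simp: half_def path_image_join)
      then show "path_image (\<lambda>t. - ?p1 t) \<subseteq> Q" "path_image (\<lambda>t. - ?p2 t) \<subseteq> Q"
        by (auto simp: path_image_def Q_def)
      show "path (\<lambda>t. - ?p1 t)" "path (\<lambda>t. - ?p2 t)" unfolding path_def by (intro continuous_intros)+
    qed auto
    have \<beta>4: "K 0 \<circ> \<beta> = ((K 0 \<circ> ?p1) +++ (K 0 \<circ> ?p2)) +++ ((K 0 \<circ> (\<lambda>t. - ?p1 t)) +++ (K 0 \<circ> (\<lambda>t. - ?p2 t)))"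
      unfolding \<beta>_def half_def neg path_compose_join ..
    have ends: "pathstart (\<lambda>t. - p t) = - pathstart p" "pathfinish (\<lambda>t. - p t) = - pathfinish p" for p :: "real \<Rightarrow> complex"
      by (auto simp: pathstart_def pathfinish_def)
    have cneg: "- Complex x y = Complex (- x) (- y)" for x y by (simp add: complex_eq_iff)
    have "winding_number (K 0 \<circ> \<beta>) 0 = winding_number (K 0 \<circ> ?p1) 0 + winding_number (K 0 \<circ> ?p2) 0
        + (winding_number (K 0 \<circ> (\<lambda>t. - ?p1 t)) 0 + winding_number (K 0 \<circ> (\<lambda>t. - ?p2 t)) 0)"
      unfolding \<beta>4 using Kpath[of 0] pq
      by (simp add: winding_number_join path_image_join pathstart_compose pathfinish_compose ends cneg)
    then show ?thesis unfolding w1 w2 w3 w4 by (simp add: turning_def)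
  qed
  then have "of_int (inum ?g ?h) = (of_int (- m) :: complex)"
    using m(2) of_int_inum[OF og] by simp
  then have "inum ?g ?h = - m" by (simp only: of_int_eq_iff)
  then show ?thesis using m(1) by simp
qed

text \<open>\<open>proper_crossing\<close> speaks of images, so it must be excluded that the curve
  reaches p along a half-axis and turns back. Near s0 the curve visits both half-axes, and its
  coordinate \<open>u\<close> vanishes only at s0; hence \<open>u\<close> changes sign there.
  \<open>\<rho>\<close> and \<open>\<sigma>\<close> serve all small r, so that two curves can later
  be cut at a common r; \<open>d\<close> stands for the direction of either axis.\<close>

lemma curve_crosses_axis:
  fixes g :: "real \<Rightarrow> complex" and d :: complex
  assumes g: "path g" and s0: "0 < s0" "s0 < 1" "g s0 = p"
    and uniq: "\<And>s. s \<in> {0..1} \<Longrightarrow> g s = p \<Longrightarrow> s = s0"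
    and U: "open U" "p \<in> U" and hom: "homeomorphism U (ball 0 1) \<phi> \<psi>" and p0: "\<phi> p = 0"
    and axis: "\<phi> ` (path_image g \<inter> U) = (\<lambda>x. of_real x * d) ` {-1<..<1}" and d: "norm d = 1"
    and \<epsilon>: "\<epsilon> > 0"
  obtains \<rho> \<sigma> where "\<rho> > 0" "\<sigma> \<in> {1, -1::real}"
    "\<And>r. 0 < r \<Longrightarrow> r < \<rho> \<Longrightarrow> \<exists>s1 s2. s0 - \<epsilon> < s1 \<and> 0 < s1 \<and> s1 < s0 \<and> s0 < s2 \<and> s2 < 1 \<and> s2 < s0 + \<epsilon> \<and>
       g ` {s1..s2} \<subseteq> U \<and> \<phi> (g s1) = of_real (- \<sigma> * r) * d \<and> \<phi> (g s2) = of_real (\<sigma> * r) * d"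
proof -
  have d0: "d \<noteq> 0" using d by auto
  have gc: "continuous_on {0..1} g" using g by (simp add: path_def)
  obtain \<epsilon>1 where \<epsilon>1: "\<epsilon>1 > 0" "\<And>s. s \<in> {0..1} \<Longrightarrow> \<bar>s - s0\<bar> < \<epsilon>1 \<Longrightarrow> g s \<in> U"
  proof -
    obtain e where e: "e > 0" "ball p e \<subseteq> U" using U openE by blast
    obtain \<delta> where "\<delta> > 0" "\<And>s. s \<in> {0..1} \<Longrightarrow> dist s s0 < \<delta> \<Longrightarrow> dist (g s) (g s0) < e"
      using gc e(1) s0 unfolding continuous_on_iff by (metis atLeastAtMost_iff less_imp_le)
    then show thesis using that[of \<delta>] e(2) s0(3) by (auto simp: dist_real_def dist_commute subset_iff)
  qed
  define \<eta> where "\<eta> = min (min \<epsilon> \<epsilon>1) (min s0 (1 - s0))"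
  have \<eta>: "\<eta> > 0" "\<eta> \<le> \<epsilon>" "\<eta> \<le> \<epsilon>1" "\<eta> \<le> s0" "\<eta> \<le> 1 - s0" using \<epsilon> \<epsilon>1 s0 by (auto simp: \<eta>_def)
  define W where "W = {s0 - \<eta><..<s0 + \<eta>}"
  have W01: "W \<subseteq> {0<..<1}" using \<eta> by (auto simp: W_def)
  have WU: "g s \<in> U" if "s \<in> W" for s
    using that W01 \<eta> by (intro \<epsilon>1(2)) (auto simp: W_def)
  define u where "u = (\<lambda>s. Re (\<phi> (g s) / d))"
  have u: "\<phi> (g s) = of_real (u s) * d" if "s \<in> W" for s
  proof -
    have "\<phi> (g s) \<in> (\<lambda>x. of_real x * d) ` {-1<..<1}"
      using WU[OF that] that W01 unfolding axis[symmetric] by (auto simp: path_image_def)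
    then show ?thesis using d0 by (auto simp: u_def)
  qed
  have ucont: "continuous_on W u"
    unfolding u_def using W01 WU d0
    by (intro continuous_intros continuous_on_compose2[OF homeomorphism_cont1[OF hom]]
          continuous_on_subset[OF gc]) auto
  have u0: "u s = 0 \<longleftrightarrow> s = s0" if "s \<in> W" for s
  proof
    assume "u s = 0"
    then have "\<phi> (g s) = \<phi> p" using u[OF that] p0 by simp
    then have "g s = p" using homeomorphism_apply1[OF hom] WU[OF that] U(2) by metis
    then show "s = s0" using uniq that W01 by auto
  qed (simp add: u_def s0 p0)
  \<comment> \<open>Points of either half-axis close to p lie on g, and by compactness only at times close to s0.\<close>
  have hits: "\<exists>s \<in> W. u s * \<tau> > 0" if \<tau>: "\<tau> \<in> {1, -1}" for \<tau>
  proof -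
    define C where "C = g ` ({0..1} - W)"
    have "compact ({0..1} - W)" unfolding W_def by (intro compact_diff) auto
    then have "closed C" unfolding C_def by (intro compact_imp_closed compact_continuous_image continuous_on_subset[OF gc]) auto
    moreover have "p \<notin> C" using uniq \<eta>(1) by (auto simp: C_def W_def)
    ultimately have "open (- C)" "\<psi> 0 \<in> - C"
      using homeomorphism_apply1[OF hom U(2)] p0 by auto
    then obtain e where e: "e > 0" "ball (\<psi> 0) e \<subseteq> - C" using openE by blast
    obtain \<delta> where \<delta>: "\<delta> > 0" "\<And>z. z \<in> ball 0 1 \<Longrightarrow> dist z 0 < \<delta> \<Longrightarrow> dist (\<psi> z) (\<psi> 0) < e"
      using homeomorphism_cont2[OF hom] e(1) unfolding continuous_on_iff by (metis centre_in_ball zero_less_one)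
    define x where "x = min \<delta> 1 / 2"
    have x: "0 < x" "x < \<delta>" "x < 1" using \<delta> by (auto simp: x_def)
    define z where "z = complex_of_real (\<tau> * x) * d"
    have z: "z \<in> ball 0 1" "dist z 0 < \<delta>" using x d \<tau> by (auto simp: z_def norm_mult)
    have "z \<in> \<phi> ` (path_image g \<inter> U)" unfolding axis z_def using x \<tau> by (intro imageI) auto
    then obtain s where s: "s \<in> {0..1}" "g s \<in> U" "\<phi> (g s) = z" by (auto simp: path_image_def)
    then have "g s = \<psi> z" using homeomorphism_apply1[OF hom] by metis
    then have "g s \<notin> C" using \<delta>(2)[OF z] e(2) by (auto simp: dist_commute subset_iff)
    then have W: "s \<in> W" using s(1) by (auto simp: C_def)
    have "u s = \<tau> * x" using s(3) u[OF W] d0 unfolding z_def by (metis mult_cancel_right of_real_eq_iff)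
    then show ?thesis using W x(1) \<tau> by (intro bexI[of _ s]) auto
  qed
  have ivt: "\<exists>s. s \<in> closed_segment a b \<and> u s = y" if "a \<in> W" "b \<in> W" "u a \<le> y" "y \<le> u b" for a b y
  proof -
    have sub: "closed_segment a b \<subseteq> W" using that(1,2) unfolding W_def
      by (intro closed_segment_subset) auto
    have "connected (u ` closed_segment a b)"
      by (intro connected_continuous_image continuous_on_subset[OF ucont sub]) simp
    then have "y \<in> u ` closed_segment a b" using that
      by (meson connectedD_interval ends_in_segment imageI)
    then show ?thesis by auto
  qed
  obtain a b where ab: "a \<in> W" "u a < 0" "b \<in> W" "u b > 0"
    using hits[of 1] hits[of "-1"] by auto
  have s0W: "s0 \<in> W" using \<eta> by (auto simp: W_def)
  have us0: "u s0 = 0" using u0[OF s0W] by simp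
  \<comment> \<open>The intermediate value theorem yields a zero of \<open>u\<close> between
    \<open>a\<close> and \<open>b\<close>, and s0 is the only candidate.\<close>
  have btw: "s0 \<in> closed_segment a b"
  proof -
    obtain s where s: "s \<in> closed_segment a b" "u s = 0" using ivt[of a b 0] ab by auto
    have "closed_segment a b \<subseteq> W" using ab unfolding W_def
      by (intro closed_segment_subset) auto
    then show ?thesis using s u0 by auto
  qed
  define \<rho> where "\<rho> = min (- u a) (u b)"
  have \<rho>: "\<rho> > 0" using ab by (auto simp: \<rho>_def)
  have pts: "\<exists>x y. x \<in> closed_segment a s0 \<and> u x = - r \<and> y \<in> closed_segment s0 b \<and> u y = r \<and> x \<in> W \<and> y \<in> W \<and> x \<noteq> s0 \<and> y \<noteq> s0"
    if r: "0 < r" "r < \<rho>" for r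
  proof -
    have le: "u a \<le> - r" "r \<le> u b" using r by (auto simp: \<rho>_def)
    obtain x where x: "x \<in> closed_segment a s0" "u x = - r"
      using ivt[of a s0 "-r"] ab s0W us0 r le by auto
    obtain y where y: "y \<in> closed_segment s0 b" "u y = r"
      using ivt[of s0 b r] ab s0W us0 r le by auto
    have "closed_segment a s0 \<subseteq> W" "closed_segment s0 b \<subseteq> W" using ab s0W unfolding W_def
      by (intro closed_segment_subset; auto)+
    then show ?thesis using x y us0 r by (intro exI[of _ x] exI[of _ y]) auto
  qed
  have abne: "a \<noteq> s0" "b \<noteq> s0" using ab us0 by auto
  show thesis
  proof (cases "a < s0")
    case True
    then have b: "s0 < b" using btw abne by (auto simp: closed_segment_eq_real_ivl split: if_splits)
    show thesis
    proof (rule that[of \<rho> 1])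
      fix r assume "0 < r" "r < \<rho>"
      then obtain x y where "x \<in> closed_segment a s0" "u x = - r" "y \<in> closed_segment s0 b" "u y = r" "x \<in> W" "y \<in> W" "x \<noteq> s0" "y \<noteq> s0"
        using pts by blast
      moreover from this have "x < s0" "s0 < y" using True b by (auto simp: closed_segment_eq_real_ivl split: if_splits)
      moreover from calculation have "{x..y} \<subseteq> W" by (auto simp: W_def)
      ultimately show "\<exists>s1 s2. s0 - \<epsilon> < s1 \<and> 0 < s1 \<and> s1 < s0 \<and> s0 < s2 \<and> s2 < 1 \<and> s2 < s0 + \<epsilon> \<and>
       g ` {s1..s2} \<subseteq> U \<and> \<phi> (g s1) = of_real (- 1 * r) * d \<and> \<phi> (g s2) = of_real (1 * r) * d"
        using u WU \<eta> W01 by (intro exI[of _ x] exI[of _ y]) (auto simp: W_def subset_iff)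
    qed (use \<rho> in auto)
  next
    case False
    then have b: "b < s0" using btw abne by (auto simp: closed_segment_eq_real_ivl split: if_splits)
    show thesis
    proof (rule that[of \<rho> "-1"])
      fix r assume "0 < r" "r < \<rho>"
      then obtain x y where "x \<in> closed_segment a s0" "u x = - r" "y \<in> closed_segment s0 b" "u y = r" "x \<in> W" "y \<in> W" "x \<noteq> s0" "y \<noteq> s0"
        using pts by blast
      moreover from this have "s0 < x" "y < s0" using False abne b by (auto simp: closed_segment_eq_real_ivl split: if_splits)
      moreover from calculation have "{y..x} \<subseteq> W" by (auto simp: W_def)
      ultimately show "\<exists>s1 s2. s0 - \<epsilon> < s1 \<and> 0 < s1 \<and> s1 < s0 \<and> s0 < s2 \<and> s2 < 1 \<and> s2 < s0 + \<epsilon> \<and>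
       g ` {s1..s2} \<subseteq> U \<and> \<phi> (g s1) = of_real (- (- 1) * r) * d \<and> \<phi> (g s2) = of_real (- 1 * r) * d"
        using u WU \<eta> W01 by (intro exI[of _ y] exI[of _ x]) (auto simp: W_def subset_iff)
    qed (use \<rho> in auto)
  qed
qed

text \<open>In the chart the curve stays in a convex set and is homotopic there to the segment with
  the same ends; carried back by \<open>\<psi>\<close>, the homotopy avoids z. An arbitrary motion
  along an axis is thus replaced by a straight one.\<close>

lemma winding_number_in_chart:
  assumes hom: "homeomorphism U (ball 0 1) \<phi> \<psi>" and g: "path g" "path_image g \<subseteq> U"
    and ax: "\<phi> ` path_image g \<subseteq> A" "convex A" "A \<subseteq> ball 0 1"
    and z: "z \<notin> \<psi> ` A"
  shows "winding_number g z = winding_number (\<psi> \<circ> linepath (\<phi> (pathstart g)) (\<phi> (pathfinish g))) z"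
proof -
  have "path (\<phi> \<circ> g)" using g homeomorphism_cont1[OF hom] by (auto intro: path_continuous_image continuous_on_subset)
  moreover have lp: "linepath (\<phi> (pathstart g)) (\<phi> (pathfinish g)) t \<in> A" if "t \<in> {0..1}" for t
    using ax(1,2) that unfolding linepath_def by (intro convexD_alt) auto
  ultimately have "homotopic_paths A (\<phi> \<circ> g) (linepath (\<phi> (pathstart g)) (\<phi> (pathfinish g)))"
    using ax(1,2) lp
    by (intro homotopic_paths_linear closed_segment_subset)
      (auto simp: pathstart_compose pathfinish_compose path_image_def image_subset_iff)
  then have "homotopic_paths (- {z}) (\<psi> \<circ> (\<phi> \<circ> g)) (\<psi> \<circ> linepath (\<phi> (pathstart g)) (\<phi> (pathfinish g)))"
    using z homeomorphism_cont2[OF hom] ax(3)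
    by (intro homotopic_paths_continuous_image[of A]) (auto intro: continuous_on_subset)
  then have "winding_number (\<psi> \<circ> (\<phi> \<circ> g)) z = winding_number (\<psi> \<circ> linepath (\<phi> (pathstart g)) (\<phi> (pathfinish g))) z"
    by (rule winding_number_homotopic_paths)
  moreover have "winding_number (\<psi> \<circ> (\<phi> \<circ> g)) z = winding_number g z"
    using g(2) homeomorphism_apply1[OF hom] by (intro winding_number_cong) (auto simp: path_image_def image_subset_iff)
  ultimately show ?thesis by simp
qed

lemma odd_inum_axes_signed:
  fixes \<psi> :: "complex \<Rightarrow> complex" and \<sigma> \<tau> r :: real
  assumes "continuous_on (ball 0 1) \<psi>" "inj_on \<psi> (ball 0 1)" "0 < r" "r < 1"
    and \<sigma>: "\<sigma> \<in> {1, -1}" and \<tau>: "\<tau> \<in> {1, -1}"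
  shows "odd (inum (\<psi> \<circ> linepath (of_real (- \<sigma> * r)) (of_real (\<sigma> * r)))
    (\<psi> \<circ> linepath (of_real (- \<tau> * r) * \<i>) (of_real (\<tau> * r) * \<i>)))"
proof -
  let ?g = "\<psi> \<circ> linepath (- of_real r) (of_real r)"
  let ?h = "\<psi> \<circ> linepath (- of_real r * \<i>) (of_real r * \<i>)"
  note odd = inum_axes_odd[OF assms(1-4)] and off = off_ends_axes[OF assms(1-4)]
  have gr: "\<psi> \<circ> linepath (of_real r) (- of_real r) = reversepath ?g"
    and hr: "\<psi> \<circ> linepath (of_real r * \<i>) (- of_real r * \<i>) = reversepath ?h"
    by (simp_all add: reversepath_def linepath_def fun_eq_iff algebra_simps)
  have rev2: "inum k (reversepath ?h) = - inum k ?h" if "off_ends k ?h" for k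
  proof -
    have "off_ends (reversepath ?h) k" by (rule off_ends_reversepath[OF off_ends_commute[OF that]])
    then have "inum k (reversepath ?h) = - inum (reversepath ?h) k" by (rule inum_commute)
    also have "\<dots> = inum ?h k" unfolding inum_reversepath[OF off_ends_commute[OF that]] by (rule minus_minus)
    also have "\<dots> = - inum k ?h" by (rule inum_commute[OF that])
    finally show ?thesis .
  qed
  show ?thesis
    using \<sigma> \<tau> odd rev2[OF off] rev2[OF off_ends_reversepath[OF off]] inum_reversepath[OF off] gr hr by auto
qed

section \<open>Parity of the number of crossings\<close>

text \<open>Both curves are cut at a common distance r before and after p in the chart. The ends of
  each piece lie off the axis of the other, so all four winding numbers in \<open>turning\<close>
  agree with those of axis segments. The bound \<open>\<epsilon>\<close> on the times of
  \<open>g\<close> allows one crossing to be isolated.\<close>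

lemma proper_crossing_odd_box:
  assumes g: "path g" and h: "path h" and pc: "proper_crossing g h p"
    and s0: "0 < s0" "s0 < 1" "g s0 = p" and t0: "0 < t0" "t0 < 1" "h t0 = p" and \<epsilon>: "\<epsilon> > 0"
  obtains s1 s2 t1 t2 where "s0 - \<epsilon> < s1" "0 < s1" "s1 < s0" "s0 < s2" "s2 < 1" "s2 < s0 + \<epsilon>"
    "0 < t1" "t1 < t0" "t0 < t2" "t2 < 1" "odd (inum (subpath s1 s2 g) (subpath t1 t2 h))"
proof -
  have us: "s = s0" if "s \<in> {0..1}" "g s = p" for s
    using pc s0 that unfolding proper_crossing_def by (metis atLeastAtMost_iff less_imp_le)
  have ut: "t = t0" if "t \<in> {0..1}" "h t = p" for t
    using pc t0 that unfolding proper_crossing_def by (metis atLeastAtMost_iff less_imp_le)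
  obtain U \<phi> \<psi> where U: "open U" "p \<in> U" and hom: "homeomorphism U (ball 0 1) \<phi> \<psi>" and p0: "\<phi> p = 0"
    and axg: "\<phi> ` (path_image g \<inter> U) = {z \<in> ball 0 1. Im z = 0}"
    and axh: "\<phi> ` (path_image h \<inter> U) = {z \<in> ball 0 1. Re z = 0}"
    using pc unfolding proper_crossing_def by auto
  have "{z \<in> ball 0 1. Im z = 0} = (\<lambda>x. of_real x * 1) ` {-1<..<1}" (is "?A1 = _")
  proof safe
    fix z :: complex assume "z \<in> ball 0 1" "Im z = 0"
    then show "z \<in> (\<lambda>x. of_real x * 1) ` {-1<..<1}"
      by (intro image_eqI[of _ _ "Re z"]) (auto simp: complex_eq_iff cmod_eq_Re)
  qed auto
  with axg have axg': "\<phi> ` (path_image g \<inter> U) = (\<lambda>x. of_real x * 1) ` {-1<..<1}" by simp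
  have "{z \<in> ball 0 1. Re z = 0} = (\<lambda>x. of_real x * \<i>) ` {-1<..<1}" (is "?A2 = _")
  proof safe
    fix z :: complex assume "z \<in> ball 0 1" "Re z = 0"
    then show "z \<in> (\<lambda>x. of_real x * \<i>) ` {-1<..<1}"
      by (intro image_eqI[of _ _ "Im z"]) (auto simp: complex_eq_iff cmod_eq_Im)
  qed (auto simp: norm_mult)
  with axh have axh': "\<phi> ` (path_image h \<inter> U) = (\<lambda>x. of_real x * \<i>) ` {-1<..<1}" by simp
  obtain \<rho> \<sigma> where \<rho>: "\<rho> > 0" and \<sigma>: "\<sigma> \<in> {1, -1::real}" and cg:
    "\<And>r. 0 < r \<Longrightarrow> r < \<rho> \<Longrightarrow> \<exists>s1 s2. s0 - \<epsilon> < s1 \<and> 0 < s1 \<and> s1 < s0 \<and> s0 < s2 \<and> s2 < 1 \<and> s2 < s0 + \<epsilon> \<and>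
       g ` {s1..s2} \<subseteq> U \<and> \<phi> (g s1) = of_real (- \<sigma> * r) * 1 \<and> \<phi> (g s2) = of_real (\<sigma> * r) * 1"
    by (rule curve_crosses_axis[OF g s0 us U hom p0 axg' _ \<epsilon>]) auto
  obtain \<rho>' \<tau> where \<rho>': "\<rho>' > 0" and \<tau>: "\<tau> \<in> {1, -1::real}" and ch:
    "\<And>r. 0 < r \<Longrightarrow> r < \<rho>' \<Longrightarrow> \<exists>s1 s2. t0 - \<epsilon> < s1 \<and> 0 < s1 \<and> s1 < t0 \<and> t0 < s2 \<and> s2 < 1 \<and> s2 < t0 + \<epsilon> \<and>
       h ` {s1..s2} \<subseteq> U \<and> \<phi> (h s1) = of_real (- \<tau> * r) * \<i> \<and> \<phi> (h s2) = of_real (\<tau> * r) * \<i>"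
    by (rule curve_crosses_axis[OF h t0 ut U hom p0 axh' _ \<epsilon>]) auto
  define r where "r = min 1 (min \<rho> \<rho>') / 2"
  have r: "0 < r" "r < 1" "r < \<rho>" "r < \<rho>'" using \<rho> \<rho>' by (auto simp: r_def)
  obtain s1 s2 where s: "s0 - \<epsilon> < s1" "0 < s1" "s1 < s0" "s0 < s2" "s2 < 1" "s2 < s0 + \<epsilon>"
    "g ` {s1..s2} \<subseteq> U" "\<phi> (g s1) = of_real (- \<sigma> * r)" "\<phi> (g s2) = of_real (\<sigma> * r)"
    using cg[OF r(1,3)] by auto
  obtain t1 t2 where t: "0 < t1" "t1 < t0" "t0 < t2" "t2 < 1"
    "h ` {t1..t2} \<subseteq> U" "\<phi> (h t1) = of_real (- \<tau> * r) * \<i>" "\<phi> (h t2) = of_real (\<tau> * r) * \<i>"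
    using ch[OF r(1,4)] by auto
  let ?g = "subpath s1 s2 g" and ?h = "subpath t1 t2 h"
  have pg: "path ?g" "path ?h" using g h s t by auto
  have ig: "path_image ?g = g ` {s1..s2}" "path_image ?h = h ` {t1..t2}" using s t by (auto simp: path_image_subpath)
  have sg: "g ` {s1..s2} \<subseteq> path_image g \<inter> U" "h ` {t1..t2} \<subseteq> path_image h \<inter> U" using s t by (auto simp: path_image_def)
  have "convex {z. Im z = 0}" "convex {z. Re z = 0}" by (auto simp: convex_def)
  then have cA: "convex ?A1" "convex ?A2"
    using convex_Int[OF convex_ball] by (auto simp: Collect_conj_eq simp del: mem_ball_0 mem_ball)
  have A1: "convex ?A1" "?A1 \<subseteq> ball 0 1" "\<phi> ` path_image ?g \<subseteq> ?A1"
    using sg(1) axg ig cA by (simp, blast, blast)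
  have A2: "convex ?A2" "?A2 \<subseteq> ball 0 1" "\<phi> ` path_image ?h \<subseteq> ?A2"
    using sg(2) axh ig cA by (simp, blast, blast)
  have off1: "h t \<notin> \<psi> ` ?A1" if "\<phi> (h t) = of_real x * \<i>" "x \<noteq> 0" for t x
    using that homeomorphism_apply2[OF hom] by auto
  have off2: "g s \<notin> \<psi> ` ?A2" if "\<phi> (g s) = of_real x" "x \<noteq> 0" for s x
    using that homeomorphism_apply2[OF hom] by auto
  let ?g' = "\<psi> \<circ> linepath (of_real (- \<sigma> * r)) (of_real (\<sigma> * r))"
  let ?h' = "\<psi> \<circ> linepath (of_real (- \<tau> * r) * \<i>) (of_real (\<tau> * r) * \<i>)"
  have nz: "- \<sigma> * r \<noteq> 0" "\<sigma> * r \<noteq> 0" "- \<tau> * r \<noteq> 0" "\<tau> * r \<noteq> 0" using \<sigma> \<tau> r by auto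
  have wg: "winding_number ?g z = winding_number ?g' z" if "z \<notin> \<psi> ` ?A1" for z
    using winding_number_in_chart[OF hom pg(1) _ A1(3,1,2) that] s ig by simp
  have wh: "winding_number ?h z = winding_number ?h' z" if "z \<notin> \<psi> ` ?A2" for z
    using winding_number_in_chart[OF hom pg(2) _ A2(3,1,2) that] t ig by simp
  have inU: "g s1 \<in> U" "g s2 \<in> U" "h t1 \<in> U" "h t2 \<in> U" using s t by auto
  have ends: "pathstart ?g' = g s1" "pathfinish ?g' = g s2" "pathstart ?h' = h t1" "pathfinish ?h' = h t2"
    using homeomorphism_apply1[OF hom] inU s(8,9) t(6,7)
    by (metis pathstart_compose pathfinish_compose pathstart_linepath pathfinish_linepath)+
  have "turning ?g ?h = turning ?g' ?h'"
    unfolding turning_def ends using off1[OF t(6) nz(3)] off1[OF t(7) nz(4)] off2[OF s(8) nz(1)] off2[OF s(9) nz(2)]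
    by (simp add: wg wh)
  then have "inum ?g ?h = inum ?g' ?h'" by (simp only: inum_def)
  moreover have "odd (inum ?g' ?h')"
    using homeomorphism_cont2[OF hom] inj_on_inverseI[of "ball 0 1" \<phi> \<psi>] homeomorphism_apply2[OF hom] r \<sigma> \<tau>
    by (intro odd_inum_axes_signed) auto
  ultimately show thesis using that[of s1 s2 t1 t2] s t by simp
qed

text \<open>Induction on the number of crossings: \<open>g\<close> is cut closely around one
  crossing, whose piece contributes an odd number, and each outer piece has fewer crossings.\<close>

lemma even_inum_subpath_iff:
  fixes g h :: "real \<Rightarrow> complex"
  defines "S \<equiv> {s \<in> {0..1}. g s \<in> path_image h}"
  assumes off: "off_ends g h" and fin: "finite S"
    and proper: "\<And>s. s \<in> S \<Longrightarrow> proper_crossing g h (g s)"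
    and "a \<in> {0..1}" "b \<in> {0..1}" "a \<le> b" "g a \<notin> path_image h" "g b \<notin> path_image h"
  shows "even (inum (subpath a b g) h) \<longleftrightarrow> even (card (S \<inter> {a..b}))"
  using assms(5-)
proof (induction "card (S \<inter> {a..b})" arbitrary: a b rule: less_induct)
  case less
  have g: "path g" and h: "path h" and h01: "h 0 \<notin> path_image g" "h 1 \<notin> path_image g"
    using off by (auto simp: off_ends_def pathstart_def pathfinish_def)
  have sub: "g ` {x..y} \<subseteq> path_image g" if "x \<in> {0..1}" "y \<in> {0..1}" for x y
    using that by (auto simp: path_image_def)
  show ?case
  proof (cases "S \<inter> {a..b} = {}")
    case True
    have "inum (subpath a b g) h = 0"
    proof (rule inum_disjoint)
      show "path_image (subpath a b g) \<inter> path_image h = {}"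
      proof (intro equals0I)
        fix z assume "z \<in> path_image (subpath a b g) \<inter> path_image h"
        then obtain x where "x \<in> {a..b}" "g x \<in> path_image h" using less.prems by (auto simp: path_image_subpath)
        then have "x \<in> S \<inter> {a..b}" using less.prems by (auto simp: S_def)
        then show False using True by blast
      qed
    qed (use g h less.prems in auto)
    then show ?thesis using True by simp
  next
    case False
    then obtain s0 where s0: "s0 \<in> S" "a \<le> s0" "s0 \<le> b" by auto
    define p where "p = g s0"
    have "s0 \<noteq> a" "s0 \<noteq> b" using s0 less.prems by (auto simp: S_def)
    then have s0': "a < s0" "s0 < b" using s0 by auto
    obtain t0 where t0: "t0 \<in> {0..1}" "h t0 = p" using s0 by (auto simp: S_def path_image_def p_def)
    have pp: "proper_crossing g h p" using proper[OF s0(1)] by (simp add: p_def)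
    have ut: "t = t0" if "t \<in> {0..1}" "h t = p" for t
      using pp t0 that unfolding proper_crossing_def by metis
    have "p \<in> path_image g" using s0 by (auto simp: p_def S_def path_image_def)
    then have "t0 \<noteq> 0" "t0 \<noteq> 1" using h01 t0 by auto
    then have t0': "0 < t0" "t0 < 1" using t0 by auto
    \<comment> \<open>\<open>\<epsilon>\<close> keeps the piece around s0 away from all other
      crossing times and from both ends of the interval.\<close>
    have "finite (insert a (insert b S) - {s0})" using fin by simp
    then obtain \<epsilon> where \<epsilon>: "\<epsilon> > 0" "\<And>x. x \<in> insert a (insert b S) - {s0} \<Longrightarrow> \<epsilon> \<le> dist s0 x"
      using finite_set_avoid[of "insert a (insert b S) - {s0}" s0] by auto
    have s01: "0 < s0" "s0 < 1" using s0' less.prems by auto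
    obtain s1 s2 t1 t2 where s: "s0 - \<epsilon> < s1" "0 < s1" "s1 < s0" "s0 < s2" "s2 < 1" "s2 < s0 + \<epsilon>"
      and t: "0 < t1" "t1 < t0" "t0 < t2" "t2 < 1" and odd: "odd (inum (subpath s1 s2 g) (subpath t1 t2 h))"
      by (rule proper_crossing_odd_box[OF g h pp s01 p_def[symmetric] t0' t0(2) \<epsilon>(1)])
    have a1: "a < s1" "s2 < b" using \<epsilon>(2)[of a] \<epsilon>(2)[of b] s0' s by (auto simp: dist_real_def)
    have only: "x = s0" if "x \<in> S" "s1 \<le> x" "x \<le> s2" for x
      using \<epsilon>(2)[of x] that s by (fastforce simp: dist_real_def)
    have gs: "g s1 \<notin> path_image h" "g s2 \<notin> path_image h"
      using only[of s1] only[of s2] s by (auto simp: S_def)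
    have cross: "x = s0 \<and> y = t0" if "x \<in> {s1..s2}" "y \<in> {0..1}" "g x = h y" for x y
    proof -
      have "x = s0" using that s by (intro only) (auto simp: S_def path_image_def)
      then show ?thesis using ut[of y] that by (simp add: p_def)
    qed
    have ab: "a \<in> {0..1}" "b \<in> {0..1}" "s1 \<in> {0..1}" "s2 \<in> {0..1}" using less.prems s by auto
    have h01': "pathstart h \<notin> g ` {x..y}" "pathfinish h \<notin> g ` {x..y}" if "x \<in> {0..1}" "y \<in> {0..1}" for x y
      using h01 sub[OF that] by (auto simp: pathstart_def pathfinish_def)
    have e1: "inum (subpath a b g) h = inum (subpath a s1 g) h + inum (subpath s1 b g) h"
      using ab a1 s s0' gs less.prems by (intro inum_subpath_split g h h01') auto
    have e2: "inum (subpath s1 b g) h = inum (subpath s1 s2 g) h + inum (subpath s2 b g) h"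
      using ab a1 s s0' gs less.prems by (intro inum_subpath_split g h h01') auto
    let ?g = "subpath s1 s2 g"
    have pg: "path ?g" and ig: "path_image ?g = g ` {s1..s2}" using g ab s by (auto simp: path_image_subpath)
    have hoff: "h y \<notin> path_image ?g" if "y \<in> {0..1}" "y \<noteq> t0" for y
      using cross[OF _ that(1)] that(2) unfolding ig by (metis imageE)
    have ends: "pathstart ?g \<notin> h ` {x..y}" "pathfinish ?g \<notin> h ` {x..y}" if "x \<in> {0..1}" "y \<in> {0..1}" for x y
      using gs that by (auto simp: path_image_def)
    \<comment> \<open>The oddness is known only for a short piece of \<open>h\<close>. Cutting
      \<open>h\<close> at t1 and t2 leaves outer pieces that miss \<open>?g\<close>, since
      \<open>h\<close> meets it only at time t0.\<close>
    have e3: "inum h ?g = inum (subpath 0 t1 h) ?g + inum (subpath t1 1 h) ?g"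
      using inum_subpath_split[OF h pg, of 0 t1 1] t hoff ends by simp
    have e4: "inum (subpath t1 1 h) ?g = inum (subpath t1 t2 h) ?g + inum (subpath t2 1 h) ?g"
      using t hoff by (intro inum_subpath_split h pg ends) auto
    have z1: "inum (subpath 0 t1 h) ?g = 0" "inum (subpath t2 1 h) ?g = 0"
    proof -
      have "path_image (subpath x y h) \<inter> path_image ?g = {}" if "0 \<le> x" "x \<le> y" "y \<le> 1" "t0 \<notin> {x..y}" for x y
        using hoff that by (fastforce simp: path_image_subpath[of x y h])
      then have "inum (subpath x y h) ?g = 0" if "0 \<le> x" "x \<le> y" "y \<le> 1" "t0 \<notin> {x..y}" for x y
        using that h pg by (intro inum_disjoint) auto
      then show "inum (subpath 0 t1 h) ?g = 0" "inum (subpath t2 1 h) ?g = 0"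
        using t by auto
    qed
    have "off_ends ?g h"
      using g h gs ab h01' s hoff[of 0] hoff[of 1] t by (auto simp: off_ends_def pathstart_def[of h] pathfinish_def[of h])
    then have "inum ?g h = - inum h ?g" using inum_commute off_ends_commute by blast
    moreover have "off_ends ?g (subpath t1 t2 h)"
      using g h gs ab s t hoff[of t1] hoff[of t2] ends[of t1 t2] by (auto simp: off_ends_def path_image_subpath)
    then have "inum ?g (subpath t1 t2 h) = - inum (subpath t1 t2 h) ?g" using inum_commute off_ends_commute by blast
    ultimately have oddm: "odd (inum ?g h)" using odd e3 e4 z1 by simp
    have split: "S \<inter> {a..b} = insert s0 (S \<inter> {a..s1} \<union> S \<inter> {s2..b})"
    proof (intro equalityI subsetI)
      fix z assume z: "z \<in> S \<inter> {a..b}"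
      then consider "z \<le> s1" | "s1 \<le> z" "z \<le> s2" | "s2 \<le> z" by linarith
      then show "z \<in> insert s0 (S \<inter> {a..s1} \<union> S \<inter> {s2..b})" using z only by cases auto
    qed (use s0 a1 s in auto)
    have "card (S \<inter> {a..s1} \<union> S \<inter> {s2..b}) = card (S \<inter> {a..s1}) + card (S \<inter> {s2..b})"
      using fin s by (intro card_Un_disjoint) auto
    then have card: "card (S \<inter> {a..b}) = Suc (card (S \<inter> {a..s1}) + card (S \<inter> {s2..b}))"
      unfolding split using fin s by (subst card_insert_disjoint) auto
    have "even (inum (subpath a s1 g) h) \<longleftrightarrow> even (card (S \<inter> {a..s1}))"
      using less.hyps[of a s1] card ab a1 gs less.prems by simp
    moreover have "even (inum (subpath s2 b g) h) \<longleftrightarrow> even (card (S \<inter> {s2..b}))"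
      using less.hyps[of s2 b] card ab a1 gs less.prems by simp
    ultimately show ?thesis using e1 e2 oddm card by simp
  qed
qed

text \<open>The induction counts times, \<open>crossings\<close> counts points. They correspond
  bijectively: \<open>g\<close> visits a proper crossing once, and \<open>off_ends\<close> excludes
  the end times.\<close>

lemma even_inum_iff_even_crossings:
  assumes off: "off_ends g h" and fin: "finite (crossings g h)"
    and proper: "\<And>p. p \<in> crossings g h \<Longrightarrow> proper_crossing g h p"
  shows "even (inum g h) \<longleftrightarrow> even (card (crossings g h))"
proof -
  define S where "S = {s \<in> {0..1}. g s \<in> path_image h}"
  have o: "g 0 \<notin> path_image h" "g 1 \<notin> path_image h" "h 0 \<notin> path_image g" "h 1 \<notin> path_image g"
    using off by (auto simp: off_ends_def pathstart_def pathfinish_def)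
  have "g ` S \<subseteq> crossings g h"
  proof safe
    fix s assume s: "s \<in> S"
    then obtain t where t: "t \<in> {0..1}" "g s = h t" by (auto simp: S_def path_image_def)
    have "g s \<in> path_image g" "g s \<in> path_image h" using s by (auto simp: S_def path_image_def)
    then have "s \<noteq> 0" "s \<noteq> 1" "t \<noteq> 0" "t \<noteq> 1" using o t(2) by metis+
    then show "g s \<in> crossings g h"
      using s t unfolding crossings_def curve_interior_def S_def
      by (intro IntI image_eqI[of "g s" g s] image_eqI[of "g s" h t]) auto
  qed
  moreover have "crossings g h \<subseteq> g ` S"
    by (force simp: crossings_def curve_interior_def S_def path_image_def)
  ultimately have im: "g ` S = crossings g h" by auto
  have inj: "inj_on g S"
  proof (rule inj_onI)
    fix s t assume "s \<in> S" "t \<in> S" "g s = g t"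
    moreover from this have "proper_crossing g h (g s)" using proper im by blast
    ultimately show "s = t" unfolding proper_crossing_def S_def by (metis (lifting) mem_Collect_eq)
  qed
  have "finite S" using inj im fin finite_image_iff by metis
  then have "even (inum (subpath 0 1 g) h) \<longleftrightarrow> even (card (S \<inter> {0..1}))"
    using off proper im o unfolding S_def by (intro even_inum_subpath_iff) auto
  moreover have "S \<inter> {0..1} = S" by (auto simp: S_def)
  ultimately show ?thesis using card_image[OF inj] im by simp
qed

section \<open>Five points joined pairwise by curves\<close>

text \<open>With a fixed logarithm of every endpoint difference, a winding number splits into a part
  that depends on the points alone and an integer.\<close>

lemma Ln_quotient_exp:
  assumes "exp (2 * of_real pi * \<i> * w) = a / b" "a \<noteq> 0" "b \<noteq> 0"
  shows "\<exists>n::int. w = Ln a / (2 * of_real pi * \<i>) - Ln b / (2 * of_real pi * \<i>) + of_int n"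
proof -
  have "exp (2 * of_real pi * \<i> * w) = exp (Ln a - Ln b)"
    using assms by (simp add: exp_diff)
  then obtain n :: int where n: "2 * of_real pi * \<i> * w = Ln a - Ln b + of_int (2 * n) * of_real pi * \<i>"
    unfolding exp_eq by auto
  have "w = (2 * of_real pi * \<i> * w) / (2 * of_real pi * \<i>)" by simp
  also have "\<dots> = Ln a / (2 * of_real pi * \<i>) - Ln b / (2 * of_real pi * \<i>) + of_int n"
    unfolding n by (simp add: add_divide_distrib diff_divide_distrib)
  finally show ?thesis by blast
qed

text \<open>Instead of a deformation to standard position, the dependence on the curves and on the
  choice of logarithms is put into integers: \<open>N i j k\<close> for the curve ij seen from point
  k, and \<open>M i j\<close> for the logarithms of x j - x i and its negative. Edge ij is disjoint
  from exactly two edges at k, so each \<open>N\<close> enters two of the 15 numbers and its parity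
  drops out.\<close>

lemma K5_odd_crossing:
  fixes x :: "nat \<Rightarrow> complex" and c :: "nat \<Rightarrow> nat \<Rightarrow> real \<Rightarrow> complex"
  assumes inj: "inj_on x {..<5}"
    and c: "\<And>i j. i < j \<Longrightarrow> j < 5 \<Longrightarrow> path (c i j) \<and> pathstart (c i j) = x i \<and> pathfinish (c i j) = x j"
    and avoid: "\<And>i j k. i < j \<Longrightarrow> j < 5 \<Longrightarrow> k < 5 \<Longrightarrow> k \<noteq> i \<Longrightarrow> k \<noteq> j \<Longrightarrow> x k \<notin> path_image (c i j)"
  shows "\<exists>i j k l. i < j \<and> j < 5 \<and> k < l \<and> l < 5 \<and> {i, j} \<inter> {k, l} = {} \<and> odd (inum (c i j) (c k l))"
proof (rule ccontr)
  assume neg: "\<not> ?thesis"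
  define I where "I i j k l = inum (c i j) (c k l)" for i j k l
  have ne: "x i \<noteq> x j" if "i < 5" "j < 5" "i \<noteq> j" for i j using that inj by (auto dest: inj_onD)
  define \<alpha> where "\<alpha> i j = Ln (x j - x i) / (2 * of_real pi * \<i>)" for i j
  have "\<exists>n::int. winding_number (c i j) (x k) = \<alpha> k j - \<alpha> k i + of_int n"
    if "i < j" "j < 5" "k < 5" "k \<noteq> i" "k \<noteq> j" for i j k
    unfolding \<alpha>_def
    using that c[of i j] avoid[of i j k] ne[of j k] ne[of i k] exp_winding_number[of "c i j" "x k"]
    by (intro Ln_quotient_exp) auto
  then obtain N :: "nat \<Rightarrow> nat \<Rightarrow> nat \<Rightarrow> int" where N:
    "\<And>i j k. i < j \<Longrightarrow> j < 5 \<Longrightarrow> k < 5 \<Longrightarrow> k \<noteq> i \<Longrightarrow> k \<noteq> j \<Longrightarrow>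
      winding_number (c i j) (x k) = \<alpha> k j - \<alpha> k i + of_int (N i j k)"
    by metis
  have "\<exists>m::int. \<alpha> i j - \<alpha> j i = of_int (2 * m + 1) / 2" if ij: "i < j" "j < 5" for i j
  proof -
    \<comment> \<open>The two differences are opposite, so their logarithms differ by an odd
      multiple of pi i.\<close>
    have q: "exp (2 * of_real pi * \<i> * (1 / 2)) = (x i - x j) / (x j - x i)"
      using ne[of i j] that by (simp add: divide_simps)
    obtain n :: int where "1 / 2 = \<alpha> j i - \<alpha> i j + of_int n"
      using Ln_quotient_exp[OF q] ne[of i j] ij unfolding \<alpha>_def by force
    then have "\<alpha> i j - \<alpha> j i = of_int (2 * (n - 1) + 1) / 2" by (simp add: field_simps)
    then show ?thesis by blast
  qed
  then obtain M :: "nat \<Rightarrow> nat \<Rightarrow> int" where M: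
    "\<And>i j. i < j \<Longrightarrow> j < 5 \<Longrightarrow> \<alpha> i j - \<alpha> j i = of_int (2 * M i j + 1) / 2"
    by metis
  \<comment> \<open>The formula for \<open>I\<close> mixes both orders of indices, so the odd
    numbers 2 M + 1 are extended antisymmetrically.\<close>
  define B where "B i j = (if i < j then 2 * M i j + 1 else - (2 * M j i + 1))" for i j
  have B: "\<alpha> i j - \<alpha> j i = of_int (B i j) / 2" if "i < 5" "j < 5" "i \<noteq> j" for i j
  proof (cases "i < j")
    case False
    then have "\<alpha> j i - \<alpha> i j = of_int (2 * M j i + 1) / 2" using that by (intro M) auto
    then show ?thesis using False by (simp add: B_def field_simps)
  qed (use M that in \<open>simp add: B_def\<close>)
  have I: "2 * I i j k l = B k j + B i k + B j l + B l i + 2 * (N i j k - N i j l + N k l j - N k l i)"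
    if "i < j" "j < 5" "k < l" "l < 5" "{i, j} \<inter> {k, l} = {}" for i j k l
  proof -
    have o: "off_ends (c i j) (c k l)"
      using that c[of i j] c[of k l] avoid[of i j k] avoid[of i j l] avoid[of k l i] avoid[of k l j]
      by (auto simp: off_ends_def)
    have b: "\<alpha> k j - \<alpha> j k = of_int (B k j) / 2" "\<alpha> i k - \<alpha> k i = of_int (B i k) / 2"
      "\<alpha> j l - \<alpha> l j = of_int (B j l) / 2" "\<alpha> l i - \<alpha> i l = of_int (B l i) / 2"
      by (rule B; use that in auto)+
    have "of_int (I i j k l) = winding_number (c i j) (x k) - winding_number (c i j) (x l)
        + winding_number (c k l) (x j) - winding_number (c k l) (x i)"
      unfolding I_def of_int_inum[OF o] turning_def using that c[of i j] c[of k l] by simp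
    also have "\<dots> = (\<alpha> k j - \<alpha> j k) + (\<alpha> i k - \<alpha> k i) + (\<alpha> j l - \<alpha> l j) + (\<alpha> l i - \<alpha> i l)
        + of_int (N i j k - N i j l + N k l j - N k l i)"
      using that N[of i j k] N[of i j l] N[of k l j] N[of k l i] by auto
    also have "\<dots> = of_int (B k j) / 2 + of_int (B i k) / 2 + of_int (B j l) / 2 + of_int (B l i) / 2
        + of_int (N i j k - N i j l + N k l j - N k l i)"
      by (simp only: b)
    finally have "of_int (2 * I i j k l) = (of_int (B k j + B i k + B j l + B l i
        + 2 * (N i j k - N i j l + N k l j - N k l i)) :: complex)"
      by (simp add: field_simps)
    then show ?thesis by (simp only: of_int_eq_iff)
  qed
  have even: "even (I i j k l)" if "i < j" "j < 5" "k < l" "l < 5" "{i, j} \<inter> {k, l} = {}" for i j k l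
    using neg that unfolding I_def by blast
  \<comment> \<open>Each N and each M occurs an even number of times over the 15 pairs; the constant 5 counts the
    five 4-subsets, each contributing one crossing pair as for points in convex position.\<close>
  have oddI: "odd s" if "2 * s = 2 * (2 * t + 5)" for s t :: int using that by presburger
  let ?S = "I 0 1 2 3 + I 0 1 2 4 + I 0 1 3 4 + I 0 2 1 3 + I 0 2 1 4
    + I 0 2 3 4 + I 0 3 1 2 + I 0 3 1 4 + I 0 3 2 4 + I 0 4 1 2
    + I 0 4 1 3 + I 0 4 2 3 + I 1 2 3 4 + I 1 3 2 4 + I 1 4 2 3"
  have "2 * ?S = 2 * (2 * (3 * M 0 1 + M 0 2 - M 0 3 - 3 * M 0 4 + M 1 2 + M 1 3 + M 1 4 + 2 * M 2 4 + N 0 1 2 - N 0 1 4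
    + N 0 2 1 - N 0 2 4 + N 0 3 1 - N 0 3 4 + N 0 4 1 - N 0 4 3 - N 1 2 0 + N 1 2 3 - N 1 3 0 + N 1
    3 2 - N 1 4 0 + N 1 4 2 - N 2 3 0 + N 2 3 4 - N 2 4 0 + N 2 4 3 - N 3 4 0 + N 3 4 2) + 5)"
    by (simp add: distrib_left I B_def)
  then have "odd ?S" by (rule oddI)
  moreover have "even ?S" by (intro dvd_add even) auto
  ultimately show False by blast
qed

section \<open>Edge bound for drawings with even disjoint pairs\<close>

text \<open>
  Arcs are ordered pairs, so the curve c u v runs from x u to x v and curves of consecutive arcs can be joined.
\<close>

definition sym_graph :: "'a set \<Rightarrow> ('a \<times> 'a) set \<Rightarrow> bool" where
  "sym_graph V A \<longleftrightarrow> finite V \<and> A \<subseteq> V \<times> V \<and> sym A \<and> irrefl A"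

text \<open>Weak enough to survive contraction: curves may overlap and repeat themselves, and the
  two arcs of an edge may carry unrelated curves.\<close>

definition even_drawing ::
  "'a set \<Rightarrow> ('a \<times> 'a) set \<Rightarrow> ('a \<Rightarrow> complex) \<Rightarrow> ('a \<Rightarrow> 'a \<Rightarrow> real \<Rightarrow> complex) \<Rightarrow> bool" where
  "even_drawing V A x c \<longleftrightarrow> inj_on x V \<and>
     (\<forall>u v. (u, v) \<in> A \<longrightarrow> path (c u v) \<and> pathstart (c u v) = x u \<and> pathfinish (c u v) = x v \<and>
        path_image (c u v) \<inter> x ` (V - {u, v}) = {}) \<and>
     (\<forall>u v w z. (u, v) \<in> A \<longrightarrow> (w, z) \<in> A \<longrightarrow> {u, v} \<inter> {w, z} = {} \<longrightarrow> even (inum (c u v) (c w z)))"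

lemma even_drawingD:
  assumes "even_drawing V A x c"
  shows "inj_on x V"
    and "(u, v) \<in> A \<Longrightarrow> path (c u v)" "(u, v) \<in> A \<Longrightarrow> pathstart (c u v) = x u"
    and "(u, v) \<in> A \<Longrightarrow> pathfinish (c u v) = x v"
    and "(u, v) \<in> A \<Longrightarrow> path_image (c u v) \<inter> x ` (V - {u, v}) = {}"
    and "(u, v) \<in> A \<Longrightarrow> (w, z) \<in> A \<Longrightarrow> {u, v} \<inter> {w, z} = {} \<Longrightarrow> even (inum (c u v) (c w z))"
  using assms unfolding even_drawing_def by simp_all

lemma even_drawing_off_ends:
  assumes "sym_graph V A" "even_drawing V A x c" "(u, v) \<in> A" "(w, z) \<in> A" "{u, v} \<inter> {w, z} = {}"
  shows "off_ends (c u v) (c w z)"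
proof -
  have "u \<in> V - {w, z}" "v \<in> V - {w, z}" "w \<in> V - {u, v}" "z \<in> V - {u, v}"
    using assms by (auto simp: sym_graph_def)
  then show ?thesis
    using even_drawingD(2-5)[OF assms(2) assms(3)] even_drawingD(2-5)[OF assms(2) assms(4)]
    unfolding off_ends_def by auto
qed

lemma even_drawing_subset:
  assumes "even_drawing V A x c" "V' \<subseteq> V" "A' \<subseteq> A"
  shows "even_drawing V' A' x c"
proof -
  have "inj_on x V'" using even_drawingD(1)[OF assms(1)] assms(2) by (rule inj_on_subset)
  moreover have "path_image (c u v) \<inter> x ` (V' - {u, v}) = {}" if "(u, v) \<in> A'" for u v
    using even_drawingD(5)[OF assms(1), of u v] that assms(2,3) by auto
  moreover have "(u, v) \<in> A" if "(u, v) \<in> A'" for u v using that assms(3) by auto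
  ultimately show ?thesis using even_drawingD(2,3,4,6)[OF assms(1)] unfolding even_drawing_def by simp
qed

lemma no_even_drawing_K5:
  assumes G: "sym_graph V A" and D: "even_drawing V A x c" and K: "K \<subseteq> V" "card K = 5"
    and adj: "\<And>a b. a \<in> K \<Longrightarrow> b \<in> K \<Longrightarrow> a \<noteq> b \<Longrightarrow> (a, b) \<in> A"
  shows False
proof -
  have "finite K" using K(2) by (intro card_ge_0_finite) simp
  then obtain f where f: "bij_betw f {0..<5::nat} K" using ex_bij_betw_nat_finite K(2) by metis
  have fK: "f i \<in> K" if "i < 5" for i using f that by (auto simp: bij_betw_def)
  have fne: "f i \<noteq> f j" if "i < 5" "j < 5" "i \<noteq> j" for i j
    using f that by (auto simp: bij_betw_def inj_on_def)
  have A: "(f i, f j) \<in> A" if "i < 5" "j < 5" "i \<noteq> j" for i j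
    using that fK fne adj by simp
  have inj: "inj_on x V" using D by (simp add: even_drawing_def)
  have "\<exists>i j k l. i < j \<and> j < 5 \<and> k < l \<and> l < 5 \<and> {i, j} \<inter> {k, l} = {} \<and>
      odd (inum (c (f i) (f j)) (c (f k) (f l)))"
  proof (rule K5_odd_crossing[of "x \<circ> f" "\<lambda>i j. c (f i) (f j)"])
    show "inj_on (x \<circ> f) {..<5}"
      using f inj K(1) unfolding bij_betw_def lessThan_atLeast0 by (auto intro!: comp_inj_on intro: inj_on_subset)
  next
    fix i j :: nat assume "i < j" "j < 5"
    then show "path (c (f i) (f j)) \<and> pathstart (c (f i) (f j)) = (x \<circ> f) i \<and> pathfinish (c (f i) (f j)) = (x \<circ> f) j"
      using A[of i j] D by (simp add: even_drawing_def)
  next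
    fix i j k :: nat assume *: "i < j" "j < 5" "k < 5" "k \<noteq> i" "k \<noteq> j"
    then have "f k \<in> V - {f i, f j}" using fK[of k] K(1) fne[of k i] fne[of k j] by auto
    moreover have "path_image (c (f i) (f j)) \<inter> x ` (V - {f i, f j}) = {}"
      using A[of i j] * D by (simp add: even_drawing_def)
    ultimately show "(x \<circ> f) k \<notin> path_image (c (f i) (f j))" by auto
  qed
  then obtain i j k l where *: "i < j" "j < 5" "k < l" "l < 5" "{i, j} \<inter> {k, l} = {}"
    and odd: "odd (inum (c (f i) (f j)) (c (f k) (f l)))" by blast
  have "{f i, f j} \<inter> {f k, f l} = {}" using * fne[of i k] fne[of i l] fne[of j k] fne[of j l] by auto
  then have "even (inum (c (f i) (f j)) (c (f k) (f l)))"
    using A[of i j] A[of k l] * by (intro even_drawingD(6)[OF D]) auto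
  then show False using odd by simp
qed

section \<open>Contraction of an edge\<close>

definition contract_arcs :: "'a \<Rightarrow> 'a \<Rightarrow> ('a \<times> 'a) set \<Rightarrow> ('a \<times> 'a) set" where
  "contract_arcs u v A =
     (\<lambda>(a, b). (if a = v then u else a, if b = v then u else b)) ` (A - {(u, v), (v, u)})"

lemma mem_contract_arcs:
  assumes "sym_graph V A" "(u, v) \<in> A"
  shows "(a, b) \<in> contract_arcs u v A \<longleftrightarrow> a \<noteq> v \<and> b \<noteq> v \<and> a \<noteq> b \<and>
     ((a, b) \<in> A \<or> a = u \<and> (v, b) \<in> A \<or> b = u \<and> (a, v) \<in> A)"
proof -
  have ir: "(a, a) \<notin> A" for a using assms by (auto simp: sym_graph_def irrefl_def)
  then have "u \<noteq> v" using assms(2) by auto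
  show ?thesis
  proof
    assume "(a, b) \<in> contract_arcs u v A"
    then show "a \<noteq> v \<and> b \<noteq> v \<and> a \<noteq> b \<and>
     ((a, b) \<in> A \<or> a = u \<and> (v, b) \<in> A \<or> b = u \<and> (a, v) \<in> A)"
      using ir \<open>u \<noteq> v\<close> unfolding contract_arcs_def by (auto split: if_splits)
  next
    assume *: "a \<noteq> v \<and> b \<noteq> v \<and> a \<noteq> b \<and>
     ((a, b) \<in> A \<or> a = u \<and> (v, b) \<in> A \<or> b = u \<and> (a, v) \<in> A)"
    then consider "(a, b) \<in> A" | "a = u" "(v, b) \<in> A" | "b = u" "(a, v) \<in> A" by auto
    then show "(a, b) \<in> contract_arcs u v A"
    proof cases
      case 1
      then show ?thesis using * unfolding contract_arcs_def by (intro image_eqI[of _ _ "(a, b)"]) auto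
    next
      case 2
      then show ?thesis using * unfolding contract_arcs_def by (intro image_eqI[of _ _ "(v, b)"]) auto
    next
      case 3
      then show ?thesis using * unfolding contract_arcs_def by (intro image_eqI[of _ _ "(a, v)"]) auto
    qed
  qed
qed

lemma sym_graph_contract:
  assumes "sym_graph V A" "(u, v) \<in> A"
  shows "sym_graph (V - {v}) (contract_arcs u v A)"
proof -
  note m = mem_contract_arcs[OF assms]
  have "contract_arcs u v A \<subseteq> (V - {v}) \<times> (V - {v})"
    using assms m by (auto simp: sym_graph_def)
  moreover have "sym (contract_arcs u v A)"
    using assms by (auto simp: sym_def m sym_graph_def)
  moreover have "irrefl (contract_arcs u v A)" by (auto simp: irrefl_def m)
  ultimately show ?thesis using assms by (simp add: sym_graph_def)
qed

text \<open>Lost are the two arcs of uv and, for each common neighbour, one arc in each direction,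
  because its arcs at v merge with those at u. Outside \<open>X\<close> the relabelling is
  injective.\<close>

lemma card_contract_arcs:
  assumes G: "sym_graph V A" and uv: "(u, v) \<in> A"
  shows "card A \<le> card (contract_arcs u v A) + 2 + 2 * card (A `` {u} \<inter> A `` {v})"
proof -
  define C where "C = A `` {u} \<inter> A `` {v}"
  have fV: "finite V" and AV: "A \<subseteq> V \<times> V" and s: "sym A" and ir: "\<And>a. (a, a) \<notin> A"
    using G by (auto simp: sym_graph_def irrefl_def)
  have fA: "finite A" using AV fV finite_subset by blast
  have fC: "finite C" using AV fV by (auto simp: C_def intro: finite_subset[of _ V])
  let ?f = "\<lambda>(a, b). (if a = v then u else a, if b = v then u else b)"
  define X where "X = {(u, v), (v, u)} \<union> {v} \<times> C \<union> C \<times> {v}"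
  have "inj_on ?f (A - X)"
  proof -
    have *: "(a, b) \<noteq> (u, v) \<and> (a, b) \<noteq> (v, u) \<and> (a = v \<longrightarrow> (u, b) \<notin> A) \<and> (b = v \<longrightarrow> (a, u) \<notin> A)"
      if "(a, b) \<in> A - X" for a b
      using that s unfolding X_def C_def by (auto dest: symD)
    show ?thesis
    proof (rule inj_onI, clarify)
      fix a b a' b' assume ab: "(a, b) \<in> A" "(a, b) \<notin> X" and ab': "(a', b') \<in> A" "(a', b') \<notin> X"
        and eq: "(if a = v then u else a) = (if a' = v then u else a')" "(if b = v then u else b) = (if b' = v then u else b')"
      show "a = a' \<and> b = b'"
        using *[of a b] *[of a' b'] ab ab' eq ir[of u] ir[of v] by (auto split: if_splits)
    qed
  qed
  then have "card (A - X) = card (?f ` (A - X))" by (simp add: card_image)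
  also have "\<dots> \<le> card (contract_arcs u v A)"
    unfolding contract_arcs_def using fA by (intro card_mono finite_imageI image_mono) (auto simp: X_def)
  finally have 1: "card (A - X) \<le> card (contract_arcs u v A)" .
  have "card X \<le> card {(u, v), (v, u)} + card ({v} \<times> C) + card (C \<times> {v})"
    using card_Un_le[of "{(u, v), (v, u)} \<union> {v} \<times> C" "C \<times> {v}"]
      card_Un_le[of "{(u, v), (v, u)}" "{v} \<times> C"] unfolding X_def by linarith
  also have "\<dots> \<le> 2 + 2 * card C"
    using card_length[of "[(u, v), (v, u)]"] by (simp add: card_cartesian_product)
  finally have "card X \<le> 2 + 2 * card C" .
  moreover have "finite X" using fC by (simp add: X_def)
  then have "card A \<le> card (A - X) + card X"
    using diff_card_le_card_Diff[of X A] by linarith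
  ultimately show ?thesis using 1 by (simp add: C_def)
qed

lemma card_contract_arcs_le:
  assumes "finite A"
  shows "card (contract_arcs u v A) \<le> card A"
  unfolding contract_arcs_def
  using assms card_image_le[of "A - {(u, v), (v, u)}"] card_mono[of A "A - {(u, v), (v, u)}"]
  by (meson Diff_subset finite_Diff le_trans)

text \<open>Every new arc contains u, so of two disjoint arcs at most one is new, and the other is
  an old arc avoiding u and v. Both halves of the new curve belong to arcs disjoint from that one,
  so \<open>inum_join\<close> adds two even numbers.\<close>

lemma even_drawing_contract:
  assumes G: "sym_graph V A" and D: "even_drawing V A x c" and uv: "(u, v) \<in> A"
  shows "\<exists>c'. even_drawing (V - {v}) (contract_arcs u v A) x c'"
proof -
  \<comment> \<open>An old arc keeps its curve even if another arc is merged into it; the other two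
    branches are the new arcs leaving and entering u.\<close>
  define c' where "c' = (\<lambda>a b. if (a, b) \<in> A then c a b
     else if a = u then c u v +++ c v b else c a v +++ c v u)"
  note m = mem_contract_arcs[OF G uv]
  have s: "(a, b) \<in> A \<Longrightarrow> (b, a) \<in> A" for a b using G by (auto simp: sym_graph_def sym_def)
  have AV: "(a, b) \<in> A \<Longrightarrow> a \<in> V \<and> b \<in> V" for a b using G by (auto simp: sym_graph_def)
  have vu: "(v, u) \<in> A" "u \<noteq> v" using s[OF uv] uv G by (auto simp: sym_graph_def irrefl_def)
  have inj: "inj_on x V" and
    P: "\<And>a b. (a, b) \<in> A \<Longrightarrow> path (c a b) \<and> pathstart (c a b) = x a \<and> pathfinish (c a b) = x b \<and>
        path_image (c a b) \<inter> x ` (V - {a, b}) = {}" and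
    E: "\<And>a b y z. (a, b) \<in> A \<Longrightarrow> (y, z) \<in> A \<Longrightarrow> {a, b} \<inter> {y, z} = {} \<Longrightarrow> even (inum (c a b) (c y z))"
    using D unfolding even_drawing_def by blast+
  have jn: "path (c a v +++ c v b) \<and> pathstart (c a v +++ c v b) = x a \<and> pathfinish (c a v +++ c v b) = x b \<and>
        path_image (c a v +++ c v b) \<inter> x ` (V - {v} - {a, b}) = {}" if "(a, v) \<in> A" "(v, b) \<in> A" for a b
    using P[OF that(1)] P[OF that(2)] by (auto simp: path_image_join)
  have P': "path (c' a b) \<and> pathstart (c' a b) = x a \<and> pathfinish (c' a b) = x b \<and>
        path_image (c' a b) \<inter> x ` (V - {v} - {a, b}) = {}" if "(a, b) \<in> contract_arcs u v A" for a b
  proof (cases "(a, b) \<in> A")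
    case True
    then show ?thesis using P[OF True] by (auto simp: c'_def)
  next
    case False
    then show ?thesis using that jn[OF uv, of b] jn[of a u] vu by (auto simp: c'_def m)
  qed
  have R: "off_ends (c' a b) (c y z) \<and> even (inum (c' a b) (c y z))"
    if ab: "(a, b) \<in> contract_arcs u v A" and yz: "(y, z) \<in> A" "{a, b, v} \<inter> {y, z} = {}" for a b y z
  proof (cases "(a, b) \<in> A")
    case True
    then show ?thesis using even_drawing_off_ends[OF G D True yz(1)] E[OF True yz(1)] yz(2) by (auto simp: c'_def)
  next
    case False
    obtain a' b' where "(a', v) \<in> A" "(v, b') \<in> A" "{a', b'} = {a, b}" "c' a b = c a' v +++ c v b'"
      using ab False vu uv by (auto simp: m c'_def)
    moreover from this have "{a', v} \<inter> {y, z} = {}" "{v, b'} \<inter> {y, z} = {}" using yz(2) by auto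
    moreover from calculation have "off_ends (c a' v) (c y z)" "off_ends (c v b') (c y z)"
      "pathfinish (c a' v) = pathstart (c v b')"
      using even_drawing_off_ends[OF G D _ yz(1)] P by auto
    ultimately show ?thesis using inum_join[of "c a' v" "c y z" "c v b'"] E[OF _ yz(1)] by auto
  qed
  have "even (inum (c' a b) (c' y z))"
    if ab: "(a, b) \<in> contract_arcs u v A" and yz: "(y, z) \<in> contract_arcs u v A" and dis: "{a, b} \<inter> {y, z} = {}" for a b y z
  proof (cases "(y, z) \<in> A")
    case True
    then have "{a, b, v} \<inter> {y, z} = {}" using yz dis by (auto simp: m)
    then show ?thesis using R[OF ab True] True by (simp add: c'_def)
  next
    case False
    then have A: "(a, b) \<in> A" using ab yz dis by (auto simp: m)
    then have "{y, z, v} \<inter> {a, b} = {}" using ab dis by (auto simp: m)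
    then have "off_ends (c' y z) (c a b)" "even (inum (c' y z) (c a b))" using R[OF yz A] by auto
    then show ?thesis using inum_commute A by (simp add: c'_def)
  qed
  moreover have "inj_on x (V - {v})" using inj by (auto intro: inj_on_subset)
  ultimately have "even_drawing (V - {v}) (contract_arcs u v A) x c'"
    unfolding even_drawing_def using P' by blast
  then show ?thesis by blast
qed

text \<open>The neighbourhood \<open>B\<close> has four or five vertices, and each vertex misses at
  most \<open>card B - 4\<close> others in it. With four it is complete; with five the non-edges
  form a matching. At most one non-edge leaves a K4 in \<open>B\<close>, and two are repaired by a
  contraction. Together with v this gives a K5.\<close>

lemma no_dense_neighbourhood:
  assumes G: "sym_graph V A" and D: "even_drawing V A x c" and v: "v \<in> V"
    and le5: "card (A `` {v}) \<le> 5" and ne: "A `` {v} \<noteq> {}"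
    and common: "\<And>w. (v, w) \<in> A \<Longrightarrow> 3 \<le> card (A `` {v} \<inter> A `` {w})"
  shows False
proof -
  define B where "B = A `` {v}"
  have fV: "finite V" and AV: "A \<subseteq> V \<times> V" and s: "\<And>a b. (a, b) \<in> A \<Longrightarrow> (b, a) \<in> A"
    and ir: "\<And>a. (a, a) \<notin> A"
    using G by (auto simp: sym_graph_def irrefl_def sym_def)
  have BV: "B \<subseteq> V" "v \<notin> B" using AV ir by (auto simp: B_def)
  then have fB: "finite B" using fV finite_subset by blast
  have vB: "(v, w) \<in> A" "(w, v) \<in> A" if "w \<in> B" for w using that s by (auto simp: B_def)
  define miss where "miss w = B - {w} - A `` {w}" for w
  have adj: "(w, z) \<in> A" if "z \<in> B" "w \<noteq> z" "z \<notin> miss w" for w z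
    using that by (auto simp: miss_def)
  have cardB: "card B = card (B \<inter> A `` {w}) + 1 + card (miss w)" if "w \<in> B" for w
  proof -
    have "B = B \<inter> A `` {w} \<union> {w} \<union> miss w" using that by (auto simp: miss_def)
    also have "card \<dots> = card (B \<inter> A `` {w} \<union> {w}) + card (miss w)"
      using fB by (intro card_Un_disjoint) (auto simp: miss_def)
    also have "card (B \<inter> A `` {w} \<union> {w}) = card (B \<inter> A `` {w}) + 1"
      using fB ir by (subst card_Un_disjoint) auto
    finally show ?thesis .
  qed
  \<comment> \<open>The vertex itself and three common neighbours account for four members of
    \<open>B\<close>.\<close>
  have miss1: "card (miss w) + 4 \<le> card B" if "w \<in> B" for w
    using cardB[OF that] common[of w] vB[OF that] by (simp add: B_def)
  have finm: "finite (miss w)" for w using fB by (simp add: miss_def)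
  have clique: False if Q: "Q \<subseteq> B" "card Q = 4" "\<And>a b. a \<in> Q \<Longrightarrow> b \<in> Q \<Longrightarrow> a \<noteq> b \<Longrightarrow> (a, b) \<in> A" for Q
  proof (rule no_even_drawing_K5[OF G D, of "insert v Q"])
    show "card (insert v Q) = 5"
      using Q BV(2) finite_subset[OF Q(1) fB] by (subst card_insert_disjoint) auto
  qed (use Q BV v vB in auto)
  obtain w0 where w0: "w0 \<in> B" using ne by (auto simp: B_def)
  have "card B = 4 \<or> card B = 5" using miss1[OF w0] le5 by (auto simp: B_def)
  then show False
  proof
    assume 4: "card B = 4"
    have "miss w = {}" if "w \<in> B" for w using miss1[OF that] 4 finm by simp
    then show False using clique[of B] 4 adj by blast
  next
    assume 5: "card B = 5"
    have single: "miss w = {z}" if "w \<in> B" "z \<in> miss w" for w z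
    proof -
      have "card (miss w) \<le> 1" using miss1[OF that(1)] 5 by simp
      then show ?thesis using that(2) finm by (metis card_le_Suc0_iff_eq One_nat_def is_singletonI' is_singleton_the_elem singletonD empty_iff)
    qed
    have msym: "w \<in> miss z" if "w \<in> B" "z \<in> miss w" for w z
      using that s by (auto simp: miss_def)
    show False
    proof (cases "\<forall>w\<in>B. miss w = {}")
      case True
      have "card (B - {w0}) = 4" using 5 w0 fB by simp
      then show False using clique[of "B - {w0}"] True adj by blast
    next
      case False
      then obtain a b where a: "a \<in> B" and b: "b \<in> miss a" by auto
      have bB: "b \<in> B" "a \<noteq> b" using b by (auto simp: miss_def)
      have ma: "miss a = {b}" "miss b = {a}" using single a b msym bB by auto
      define R where "R = B - {a, b}"
      have R3: "card R = 3" using 5 a bB fB by (simp add: R_def card_Diff_subset)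
      have fR: "finite R" using fB by (simp add: R_def)
      show False
      proof (cases "\<forall>w\<in>R. \<forall>z\<in>R. w \<noteq> z \<longrightarrow> (w, z) \<in> A")
        case True
        have card: "card (insert a R) = 4" using R3 fR by (simp add: R_def)
        have aR: "(a, w) \<in> A" "(w, a) \<in> A" if "w \<in> R" for w
          using that adj[of w a] ma s by (auto simp: R_def)
        have "(y, z) \<in> A" if "y \<in> insert a R" "z \<in> insert a R" "y \<noteq> z" for y z
          using that True aR by blast
        moreover have "insert a R \<subseteq> B" using a by (auto simp: R_def)
        ultimately show False using clique[OF _ card] by blast
      next
        case False
        then obtain p d where p: "p \<in> R" and d: "d \<in> R" "p \<noteq> d" "(p, d) \<notin> A" by auto
        have "card (R - {p, d}) = 1" using R3 p d fR by (simp add: card_Diff_subset)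
        then obtain e where "R - {p, d} = {e}" by (auto simp: card_1_singleton_iff)
        then have e: "e \<in> R" "e \<noteq> p" "e \<noteq> d" by auto
        have pdB: "p \<in> B" "d \<in> B" "e \<in> B" using p d e by (auto simp: R_def)
        have "d \<in> miss p" using d pdB by (auto simp: miss_def)
        then have mp: "miss p = {d}" "miss d = {p}" using single msym pdB by auto
        have dist: "a \<noteq> p" "a \<noteq> d" "a \<noteq> e" "b \<noteq> p" "b \<noteq> d" "b \<noteq> e" using p d e by (auto simp: R_def)
        \<comment> \<open>Contracting ap repairs both non-edges: the merged vertex a reaches b
          through p and keeps its own edge to d, while b, d, e are already pairwise
          adjacent.\<close>
        have edges: "(a, p) \<in> A" "(a, d) \<in> A" "(a, e) \<in> A" "(b, p) \<in> A" "(b, d) \<in> A" "(b, e) \<in> A" "(d, e) \<in> A"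
          using adj ma mp dist pdB a bB e d by auto
        have vne: "v \<noteq> a" "v \<noteq> b" "v \<noteq> p" "v \<noteq> d" "v \<noteq> e" using BV(2) a bB pdB by auto
        note m = mem_contract_arcs[OF G edges(1)]
        obtain c' where D': "even_drawing (V - {p}) (contract_arcs a p A) x c'"
          using even_drawing_contract[OF G D edges(1)] by blast
        show False
        proof (rule no_even_drawing_K5[OF sym_graph_contract[OF G edges(1)] D', of "{v, a, b, d, e}"])
          show "{v, a, b, d, e} \<subseteq> V - {p}" using BV a bB pdB v dist vne d e by auto
          show "card {v, a, b, d, e} = 5" using dist vne bB d e by simp
          fix y z assume yz: "y \<in> {v, a, b, d, e}" "z \<in> {v, a, b, d, e}" "y \<noteq> z"
          show "(y, z) \<in> contract_arcs a p A"
            unfolding m using yz dist vne bB d e edges edges[THEN s] vB a pdB by auto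
        qed
      qed
    qed
  qed
qed

text \<open>With two arcs per edge the bound reads m \<le> 3n - 2. In a smallest counterexample,
  deleting an edge shows that the average degree is below 6, and contracting one shows that adjacent
  vertices have three common neighbours. So some vertex has degree at most 5; it is not isolated, as
  it could be deleted, and \<open>no_dense_neighbourhood\<close> applies to it.\<close>

lemma even_drawing_card_arcs:
  assumes "sym_graph V A" "even_drawing V A x c" "V \<noteq> {}"
  shows "card A + 2 < 6 * card V"
  using assms
proof (induction "card V + card A" arbitrary: V A c rule: less_induct)
  case less
  note G = less.prems(1) and D = less.prems(2)
  have fV: "finite V" and AV: "A \<subseteq> V \<times> V" and s: "\<And>a b. (a, b) \<in> A \<Longrightarrow> (b, a) \<in> A"
    and ir: "\<And>a. (a, a) \<notin> A"
    using G by (auto simp: sym_graph_def irrefl_def sym_def)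
  have fA: "finite A" using AV fV finite_subset by blast
  have V1: "card V \<ge> 1" using less.prems(3) fV by (simp add: Suc_le_eq card_gt_0_iff)
  show ?case
  proof (rule ccontr)
    assume "\<not> ?thesis"
    then have big: "6 * card V \<le> card A + 2" by simp
    then have "card A > 0" using V1 by linarith
    then obtain a b where ab: "(a, b) \<in> A" by (metis card_gt_0_iff equals0I surj_pair)
    have small: "card A < 6 * card V"
    proof (rule ccontr)
      assume large: "\<not> ?thesis"
      define A' where "A' = A - {(a, b), (b, a)}"
      have "card A' < card A" unfolding A'_def using ab fA by (intro psubset_card_mono) auto
      moreover have "card A \<le> card A' + 2"
      proof -
        have "card {(a, b), (b, a)} \<le> 2" using card_length[of "[(a, b), (b, a)]"] by simp
        then show ?thesis using diff_card_le_card_Diff[of "{(a, b), (b, a)}" A] by (simp add: A'_def)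
      qed
      moreover have "sym_graph V A'" using G by (auto simp: sym_graph_def A'_def sym_def irrefl_def)
      moreover have "even_drawing V A' x c" using D by (rule even_drawing_subset) (auto simp: A'_def)
      ultimately have "card A' + 2 < 6 * card V" using less.hyps less.prems(3) by simp
      then show False using large \<open>card A \<le> card A' + 2\<close> by simp
    qed
    have common: "3 \<le> card (A `` {u} \<inter> A `` {v})" if uv: "(u, v) \<in> A" for u v
    proof (rule ccontr)
      assume few: "\<not> ?thesis"
      obtain c' where D': "even_drawing (V - {v}) (contract_arcs u v A) x c'"
        using even_drawing_contract[OF G D uv] by blast
      have V': "u \<in> V - {v}" "v \<in> V" using uv AV ir by auto
      then have cV: "card (V - {v}) = card V - 1" using fV by simp
      have "card (V - {v}) + card (contract_arcs u v A) < card V + card A"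
        using cV V1 card_contract_arcs_le[OF fA, of u v] by linarith
      then have "card (contract_arcs u v A) + 2 < 6 * card (V - {v})"
        using less.hyps sym_graph_contract[OF G uv] D' V' by blast
      \<comment> \<open>Two arcs for the edge itself and two for each of at most two common
        neighbours, exactly what the loss of one vertex permits.\<close>
      moreover have "card A \<le> card (contract_arcs u v A) + 6"
        using card_contract_arcs[OF G uv] few by simp
      ultimately show False using big cV V1 by simp
    qed
    obtain v where v: "v \<in> V" "card (A `` {v}) \<le> 5"
    proof (rule ccontr)
      assume "\<not> thesis"
      then have "6 \<le> card (A `` {v})" if "v \<in> V" for v using that \<open>\<And>v. \<lbrakk>v \<in> V; card (A `` {v}) \<le> 5\<rbrakk> \<Longrightarrow> thesis\<close> by force
      then have "(\<Sum>v\<in>V. 6) \<le> (\<Sum>v\<in>V. card (A `` {v}))" by (intro sum_mono) auto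
      also have "\<dots> = card (SIGMA v:V. A `` {v})"
        using fV fA by (subst card_SigmaI) (auto intro: finite_Image)
      also have "(SIGMA v:V. A `` {v}) = A" using AV by auto
      finally show False using small by simp
    qed
    have "A `` {v} \<noteq> {}"
    proof
      assume iso: "A `` {v} = {}"
      then have A': "A \<subseteq> (V - {v}) \<times> (V - {v})" using AV s by blast
      have cV: "card (V - {v}) = card V - 1" using fV v by simp
      have "sym_graph (V - {v}) A" using G A' by (simp add: sym_graph_def)
      moreover have "even_drawing (V - {v}) A x c" using D by (rule even_drawing_subset) auto
      moreover have "V - {v} \<noteq> {}" using A' ab by auto
      moreover have "card (V - {v}) + card A < card V + card A" using cV V1 by linarith
      ultimately have "card A + 2 < 6 * card (V - {v})" using less.hyps by blast
      then show False using big cV by simp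
    qed
    then show False using no_dense_neighbourhood[OF G D v] common by blast
  qed
qed

section \<open>The crossing lemma\<close>

lemma even_inum_reversepath_right:
  assumes "off_ends g h"
  shows "even (inum g (reversepath h)) \<longleftrightarrow> even (inum g h)"
proof -
  have "off_ends (reversepath h) g" by (rule off_ends_reversepath[OF off_ends_commute[OF assms]])
  then have "inum g (reversepath h) = - inum (reversepath h) g" by (rule inum_commute)
  then show ?thesis
    using inum_commute[OF assms] inum_reversepath[OF off_ends_commute[OF assms]] by simp
qed

lemma path_image_eq_curve_interior: "path_image g = curve_interior g \<union> {pathstart g, pathfinish g}"
proof -
  have "{0..1} = {0<..<1} \<union> {0, 1::real}" by auto
  then show ?thesis by (auto simp: path_image_def curve_interior_def pathstart_def pathfinish_def)
qed

lemma drawing_vertex_notin_edge: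
  assumes G: "simple_graph V E" and D: "drawing V E pos c" and e: "e \<in> E" and w: "w \<in> V" "w \<notin> e"
  shows "pos w \<notin> path_image (c e)"
proof -
  have "e \<subseteq> V" using G e by (auto simp: simple_graph_def)
  then have "pos w \<notin> pos ` e" using D w unfolding drawing_def by (metis inj_on_image_mem_iff)
  moreover have "curve_interior (c e) \<inter> pos ` V = {}" "{pathstart (c e), pathfinish (c e)} = pos ` e"
    using D e unfolding drawing_def by auto
  ultimately show ?thesis using w(1) unfolding path_image_eq_curve_interior by auto
qed

lemma drawing_off_ends:
  assumes G: "simple_graph V E" and D: "drawing V E pos c" and e: "e \<in> E" and f: "f \<in> E" and "e \<inter> f = {}"
  shows "off_ends (c e) (c f)"
proof -
  have ends: "path (c e)" "path (c f)" "{pathstart (c e), pathfinish (c e)} = pos ` e" "{pathstart (c f), pathfinish (c f)} = pos ` f"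
    using D e f unfolding drawing_def by auto
  have sub: "e \<subseteq> V" "f \<subseteq> V" using G e f by (auto simp: simple_graph_def)
  have "p \<notin> path_image (c f)" if "p \<in> pos ` e" for p
    using that drawing_vertex_notin_edge[OF G D f] sub assms(5) by auto
  moreover have "p \<notin> path_image (c e)" if "p \<in> pos ` f" for p
    using that drawing_vertex_notin_edge[OF G D e] sub assms(5) by auto
  moreover have "pathstart (c e) \<in> pos ` e" "pathfinish (c e) \<in> pos ` e" "pathstart (c f) \<in> pos ` f" "pathfinish (c f) \<in> pos ` f"
    using ends by auto
  ultimately show ?thesis using ends(1,2) by (simp add: off_ends_def)
qed

text \<open>Each edge becomes two opposite arcs, which halves the arc bound. Relaxing 3n - 2 to 3n
  admits the empty vertex set, which occurs among the sampled subsets.\<close>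

lemma independently_even_card_edges:
  assumes G: "simple_graph V E" and D: "drawing V E pos c"
    and even: "\<And>e f. e \<in> E \<Longrightarrow> f \<in> E \<Longrightarrow> e \<inter> f = {} \<Longrightarrow> even (card (crossings (c e) (c f)))"
  shows "card E \<le> 3 * card V"
proof (cases "V = {}")
  case True
  then have "E = {}" using G by (auto simp: simple_graph_def)
  then show ?thesis by simp
next
  case False
  have fV: "finite V" and E2: "\<And>e. e \<in> E \<Longrightarrow> e \<subseteq> V \<and> card e = 2" using G by (auto simp: simple_graph_def)
  have fE: "finite E" using simple_graph_card_le(1)[OF G] .
  have inj: "inj_on pos V" using D by (simp add: drawing_def)
  define A where "A = {(u, v). {u, v} \<in> E}"
  have A: "(u, v) \<in> A \<longleftrightarrow> {u, v} \<in> E" for u v by (simp add: A_def)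
  have Ane: "u \<noteq> v" "u \<in> V" "v \<in> V" if "(u, v) \<in> A" for u v
    using E2[of "{u, v}"] that by (auto simp: A)
  have SG: "sym_graph V A"
    unfolding sym_graph_def
  proof (intro conjI)
    show "A \<subseteq> V \<times> V" using Ane by auto
    show "sym A" by (auto simp: sym_def A insert_commute)
    show "irrefl A" using Ane(1) by (auto simp: irrefl_def simp del: insert_absorb2)
  qed (rule fV)
  \<comment> \<open>A drawing may parametrise an edge in either direction, whereas the curve of an
    arc must start at its first vertex.\<close>
  define c' where "c' u v = (if pathstart (c {u, v}) = pos u then c {u, v} else reversepath (c {u, v}))" for u v
  have "even_drawing V A pos c'"
    unfolding even_drawing_def
  proof (intro conjI allI impI)
    fix u v assume uv: "(u, v) \<in> A"
    then have e: "{u, v} \<in> E" by (simp add: A)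
    have "path (c {u, v})" and ends: "{pathstart (c {u, v}), pathfinish (c {u, v})} = {pos u, pos v}"
      using D e by (auto simp: drawing_def)
    then show "path (c' u v)" by (simp add: c'_def)
    have "pos u \<noteq> pos v" using inj Ane[OF uv] by (auto dest: inj_onD)
    then show "pathstart (c' u v) = pos u" "pathfinish (c' u v) = pos v"
      using ends by (auto simp: c'_def doubleton_eq_iff)
    have "path_image (c' u v) = path_image (c {u, v})" by (simp add: c'_def)
    then show "path_image (c' u v) \<inter> pos ` (V - {u, v}) = {}"
      using drawing_vertex_notin_edge[OF G D e] by auto
  next
    fix u v w z assume uv: "(u, v) \<in> A" and wz: "(w, z) \<in> A" and dis: "{u, v} \<inter> {w, z} = {}"
    let ?g = "c {u, v}" and ?h = "c {w, z}"
    have e: "{u, v} \<in> E" "{w, z} \<in> E" using uv wz by (auto simp: A)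
    have off: "off_ends ?g ?h" using drawing_off_ends[OF G D e dis] .
    have "{u, v} \<noteq> {w, z}" using dis by auto
    then have "even (inum ?g ?h) \<longleftrightarrow> even (card (crossings ?g ?h))"
      using D e by (intro even_inum_iff_even_crossings[OF off]) (auto simp: drawing_def)
    then have ev: "even (inum ?g ?h)" using even[OF e dis] by simp
    then have ev2: "even (inum ?g (c' w z))"
      using even_inum_reversepath_right[OF off] by (simp add: c'_def)
    have "off_ends ?g (c' w z)" using off off_ends_reversepath off_ends_commute by (auto simp: c'_def)
    then show "even (inum (c' u v) (c' w z))" using ev2 inum_reversepath by (auto simp: c'_def[of u v])
  qed (rule inj)
  then have "card A + 2 < 6 * card V" using even_drawing_card_arcs[OF SG _ False] by blast
  moreover have "card A = 2 * card E"
  proof -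
    define P where "P e = {(u, v). {u, v} = e}" for e :: "'a set"
    have P2: "finite (P e) \<and> card (P e) = 2" if e: "e \<in> E" for e
    proof -
      obtain a b where "e = {a, b}" "a \<noteq> b" using E2[OF e] by (auto simp: card_2_iff)
      then have "P e = {(a, b), (b, a)}" by (auto simp: P_def doubleton_eq_iff)
      then show ?thesis using \<open>a \<noteq> b\<close> by simp
    qed
    have "A = (\<Union>e\<in>E. P e)" by (auto simp: A_def P_def)
    also have "card \<dots> = (\<Sum>e\<in>E. card (P e))"
      using fE P2 by (intro card_UN_disjoint) (auto simp: P_def)
    also have "\<dots> = 2 * card E" using P2 by simp
    finally show ?thesis .
  qed
  ultimately show ?thesis by simp
qed

text \<open>Ordered pairs, so every pair of edges is counted twice.\<close>

definition odd_pairs :: "('a set \<Rightarrow> real \<Rightarrow> complex) \<Rightarrow> 'a set set \<Rightarrow> ('a set \<times> 'a set) set" where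
  "odd_pairs c E = {(e, f). e \<in> E \<and> f \<in> E \<and> e \<inter> f = {} \<and> odd (card (crossings (c e) (c f)))}"

lemma drawing_subgraph:
  assumes "drawing V E pos c" "V' \<subseteq> V" "E' \<subseteq> E"
  shows "drawing V' E' pos c"
proof -
  have *: "inj_on pos V'" using assms inj_on_subset by (auto simp: drawing_def)
  have "curve_interior (c e) \<inter> pos ` V' = {}" if "e \<in> E'" for e
    using assms that by (fastforce simp: drawing_def)
  then show ?thesis using * assms(1,3) unfolding drawing_def by (auto simp: subset_iff)
qed

text \<open>Deleting an edge of an odd pair lowers the left side by 2 and removes at least two
  ordered pairs; when no odd pair is left, the even case applies.\<close>

lemma card_edges_le_odd_pairs:
  assumes "simple_graph V E" "drawing V E pos c"
  shows "2 * card E \<le> 6 * card V + card (odd_pairs c E)"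
  using assms
proof (induction "card E" arbitrary: E rule: less_induct)
  case less
  have fE: "finite E" using simple_graph_card_le(1)[OF less.prems(1)] .
  have fO: "finite (odd_pairs c E)"
    by (rule finite_subset[of _ "E \<times> E"]) (auto simp: odd_pairs_def fE)
  show ?case
  proof (cases "odd_pairs c E = {}")
    case True
    then have "card E \<le> 3 * card V"
      by (intro independently_even_card_edges[OF less.prems]) (auto simp: odd_pairs_def)
    then show ?thesis by simp
  next
    case False
    then obtain e f where ef: "(e, f) \<in> odd_pairs c E" by auto
    then have fe: "(f, e) \<in> odd_pairs c E" and e: "e \<in> E"
      by (auto simp: odd_pairs_def crossings_def Int_commute)
    \<comment> \<open>Disjoint sets coincide only if they are empty; that e and f differ makes (e,
      f) and (f, e) two ordered pairs.\<close>
    have "e \<noteq> {}" using less.prems(1) e by (force simp: simple_graph_def)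
    then have ne: "e \<noteq> f" using ef by (auto simp: odd_pairs_def)
    define E' where "E' = E - {e}"
    have cE: "card E = Suc (card E')" using e fE unfolding E'_def by (metis card.remove)
    have "simple_graph V E'" "drawing V E' pos c"
      using less.prems drawing_subgraph[OF less.prems(2)] by (auto simp: simple_graph_def E'_def)
    then have "2 * card E' \<le> 6 * card V + card (odd_pairs c E')" using less.hyps[of E'] cE by simp
    moreover have "odd_pairs c E' \<subseteq> odd_pairs c E - {(e, f), (f, e)}" by (auto simp: odd_pairs_def E'_def)
    then have "card (odd_pairs c E') \<le> card (odd_pairs c E - {(e, f), (f, e)})"
      using fO by (intro card_mono) auto
    moreover have "card (odd_pairs c E - {(e, f), (f, e)}) = card (odd_pairs c E) - 2"
      using ef fe ne by (subst card_Diff_subset) auto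
    moreover have "card {(e, f), (f, e)} \<le> card (odd_pairs c E)"
      using ef fe fO by (intro card_mono) auto
    ultimately show ?thesis using cE ne by simp
  qed
qed

section \<open>Expectations over random vertex sets\<close>

lemma sum_subset_weights:
  fixes p :: real
  assumes V: "finite V" and T: "T \<subseteq> V"
  shows "(\<Sum>S\<in>Pow V. p ^ card S * (1 - p) ^ card (V - S) * of_bool (T \<subseteq> S)) = p ^ card T"
proof -
  \<comment> \<open>Giving the vertices of \<open>T\<close> the factor 0 when they are left out
    annihilates every \<open>S\<close> that does not contain \<open>T\<close>, so the sum factors
    over \<open>V\<close>.\<close>
  let ?g = "\<lambda>v. if v \<in> T then 0 else 1 - p"
  have "(\<Sum>S\<in>Pow V. (\<Prod>v\<in>S. p) * (\<Prod>v\<in>V-S. ?g v)) = (\<Prod>v\<in>V. p + ?g v)"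
    using prod_add[OF V, of "\<lambda>_. p" ?g] by simp
  also have "\<dots> = (\<Prod>v\<in>V. if v \<in> T then p else 1)" by (intro prod.cong) auto
  also have "\<dots> = p ^ card T"
    using V T by (simp add: prod.If_cases Int_absorb1)
  finally have 1: "(\<Sum>S\<in>Pow V. (\<Prod>v\<in>S. p) * (\<Prod>v\<in>V-S. ?g v)) = p ^ card T" .
  have "(\<Prod>v\<in>V-S. ?g v) = (1 - p) ^ card (V - S) * of_bool (T \<subseteq> S)" if "S \<in> Pow V" for S
  proof (cases "T \<subseteq> S")
    case True
    then have "(\<Prod>v\<in>V-S. ?g v) = (\<Prod>v\<in>V-S. 1 - p)" by (intro prod.cong) auto
    then show ?thesis using True by simp
  next
    case False
    then obtain t where "t \<in> V - S" "t \<in> T" using T by auto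
    then have "(\<Prod>v\<in>V-S. ?g v) = 0" using V by (intro prod_zero) auto
    then show ?thesis using False by simp
  qed
  then show ?thesis unfolding 1[symmetric] by (intro sum.cong) (auto simp: mult.assoc)
qed

text \<open>Linearity of expectation. The family is indexed by \<open>F\<close> because different
  members may occupy the same vertices, as (e, f) and (f, e) do.\<close>

lemma sum_subset_weights_card:
  fixes p :: real and F :: "'b set" and T :: "'b \<Rightarrow> 'a set"
  assumes V: "finite V" and F: "finite F" and T: "\<And>i. i \<in> F \<Longrightarrow> T i \<subseteq> V \<and> card (T i) = d"
  shows "(\<Sum>S\<in>Pow V. p ^ card S * (1 - p) ^ card (V - S) * card {i \<in> F. T i \<subseteq> S}) = card F * p ^ d"
proof -
  have "real (card {i \<in> F. T i \<subseteq> S}) = (\<Sum>i\<in>F. of_bool (T i \<subseteq> S))" for S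
    using F by (simp add: Int_def)
  then have "(\<Sum>S\<in>Pow V. p ^ card S * (1 - p) ^ card (V - S) * card {i \<in> F. T i \<subseteq> S})
     = (\<Sum>S\<in>Pow V. \<Sum>i\<in>F. p ^ card S * (1 - p) ^ card (V - S) * of_bool (T i \<subseteq> S))"
    by (simp only: sum_distrib_left)
  also have "\<dots> = (\<Sum>i\<in>F. \<Sum>S\<in>Pow V. p ^ card S * (1 - p) ^ card (V - S) * of_bool (T i \<subseteq> S))"
    by (rule sum.swap)
  also have "\<dots> = (\<Sum>i\<in>F. p ^ d)"
    using T by (intro sum.cong refl) (simp add: sum_subset_weights[OF V])
  finally show ?thesis by simp
qed

text \<open>Averages the linear bound over random induced subgraphs: a vertex survives with
  probability p, an edge with p^2, and a disjoint pair, which occupies four vertices, with p^4.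
  Counting ordered pairs turns the 64 into 32.\<close>

lemma odd_crossing_lemma:
  assumes G: "simple_graph V E" and D: "drawing V E pos c" and "V \<noteq> {}" and "4 * card V \<le> card E"
  shows "real (card E) ^ 3 \<le> 32 * real (card V) ^ 2 * card (odd_pairs c E)"
proof -
  define n m X where "n = real (card V)" and "m = real (card E)" and "X = real (card (odd_pairs c E))"
  have fV: "finite V" and E2: "\<And>e. e \<in> E \<Longrightarrow> e \<subseteq> V \<and> card e = 2" using G by (auto simp: simple_graph_def)
  have fE: "finite E" using simple_graph_card_le(1)[OF G] .
  have fO: "finite (odd_pairs c E)"
    by (rule finite_subset[of _ "E \<times> E"]) (auto simp: odd_pairs_def fE)
  have n: "n > 0" using assms(3) fV by (simp add: n_def card_gt_0_iff)
  have m: "4 * n \<le> m" using assms(4) by (simp add: n_def m_def)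
  then have "m > 0" using n by linarith
  note m = m this
  \<comment> \<open>At most 1 because \<open>4 * card V \<le> card E\<close>. The factor 4 makes m
    p^2 equal to 4 n p, so that n p remains after subtracting 3 n p.\<close>
  define p where "p = 4 * n / m"
  have p: "0 < p" "p \<le> 1" using n m by (auto simp: p_def)
  define w where "w S = p ^ card S * (1 - p) ^ card (V - S)" for S
  have w: "w S \<ge> 0" for S using p by (simp add: w_def)
  have sub: "2 * real (card {e \<in> E. e \<subseteq> S}) \<le> 6 * real (card {v \<in> V. {v} \<subseteq> S})
      + real (card {q \<in> odd_pairs c E. fst q \<union> snd q \<subseteq> S})" if "S \<in> Pow V" for S
  proof -
    have "simple_graph S {e \<in> E. e \<subseteq> S}" using that fV E2 finite_subset by (auto simp: simple_graph_def)
    moreover have "drawing S {e \<in> E. e \<subseteq> S} pos c" using drawing_subgraph[OF D] that by auto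
    ultimately have "2 * card {e \<in> E. e \<subseteq> S} \<le> 6 * card S + card (odd_pairs c {e \<in> E. e \<subseteq> S})"
      by (rule card_edges_le_odd_pairs)
    moreover have "odd_pairs c {e \<in> E. e \<subseteq> S} = {q \<in> odd_pairs c E. fst q \<union> snd q \<subseteq> S}"
      by (auto simp: odd_pairs_def)
    moreover have "{v \<in> V. {v} \<subseteq> S} = S" using that by auto
    ultimately show ?thesis by simp
  qed
  have "(\<Sum>S\<in>Pow V. w S * (2 * real (card {e \<in> E. e \<subseteq> S}))) \<le>
      (\<Sum>S\<in>Pow V. w S * (6 * real (card {v \<in> V. {v} \<subseteq> S}) + real (card {q \<in> odd_pairs c E. fst q \<union> snd q \<subseteq> S})))"
    using sub w by (intro sum_mono mult_left_mono) auto
  then have "2 * (\<Sum>S\<in>Pow V. w S * real (card {e \<in> E. e \<subseteq> S})) \<le>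
      6 * (\<Sum>S\<in>Pow V. w S * real (card {v \<in> V. {v} \<subseteq> S}))
      + (\<Sum>S\<in>Pow V. w S * real (card {q \<in> odd_pairs c E. fst q \<union> snd q \<subseteq> S}))"
    by (simp add: distrib_left sum.distrib sum_distrib_left mult.left_commute)
  moreover have "(\<Sum>S\<in>Pow V. w S * real (card {e \<in> E. e \<subseteq> S})) = m * p ^ 2"
    unfolding w_def m_def using E2 by (intro sum_subset_weights_card[OF fV fE]) auto
  moreover have "(\<Sum>S\<in>Pow V. w S * real (card {v \<in> V. {v} \<subseteq> S})) = n * p ^ 1"
    unfolding w_def n_def by (intro sum_subset_weights_card[OF fV fV]) auto
  moreover have "(\<Sum>S\<in>Pow V. w S * real (card {q \<in> odd_pairs c E. fst q \<union> snd q \<subseteq> S})) = X * p ^ 4"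
    unfolding w_def X_def
  proof (intro sum_subset_weights_card[OF fV fO])
    fix q assume "q \<in> odd_pairs c E"
    then have "fst q \<in> E" "snd q \<in> E" "fst q \<inter> snd q = {}" by (auto simp: odd_pairs_def)
    moreover from this have "finite (fst q)" "finite (snd q)" using E2 by (meson fV finite_subset)+
    ultimately show "fst q \<union> snd q \<subseteq> V \<and> card (fst q \<union> snd q) = 4"
      using E2 by (simp add: card_Un_disjoint)
  qed
  ultimately have "2 * (m * p ^ 2) \<le> 6 * (n * p) + X * p ^ 4" by simp
  moreover have "m * p ^ 2 = 4 * (n * p)" using m by (simp add: p_def power2_eq_square)
  ultimately have "2 * (n * p) \<le> X * p ^ 4" by linarith
  then have "p * (2 * n) \<le> p * (X * p ^ 3)" by (simp add: power_numeral_reduce algebra_simps)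
  then have "2 * n \<le> X * p ^ 3" using p by simp
  also have "p ^ 3 = 64 * n ^ 3 / m ^ 3" by (simp add: p_def power_divide power_mult_distrib)
  finally have "2 * n * m ^ 3 \<le> X * (64 * n ^ 3)" using m by (simp add: field_simps)
  then have "(2 * n) * m ^ 3 \<le> (2 * n) * (32 * n ^ 2 * X)"
    by (simp add: power_numeral_reduce algebra_simps)
  then show ?thesis using n by (simp add: n_def m_def X_def ac_simps)
qed

text \<open>Summed over all edges, the condition bounds the ordered odd pairs by k m, and the
  crossing lemma gives m^2 \<le> 32 k n^2 after division by m. If m < 4n, then m^2 \<le> 16 n^2,
  which is enough since k is at least 1.\<close>

lemma k_odd_planar_card_edges:
  assumes G: "simple_graph V E" and K: "k_odd_planar k V E" and "V \<noteq> {}" "k \<ge> 1"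
  shows "real (card E) ^ 2 \<le> 32 * real k * real (card V) ^ 2"
proof (cases "4 * card V \<le> card E")
  case True
  obtain pos c where D: "drawing V E pos c"
    and k: "\<And>e. e \<in> E \<Longrightarrow> card {f \<in> E. f \<noteq> e \<and> odd (card (crossings (c e) (c f)))} \<le> k"
    using K by (auto simp: k_odd_planar_def)
  have fE: "finite E" using simple_graph_card_le(1)[OF G] .
  have "finite V" using G by (simp add: simple_graph_def)
  then have pos: "card E > 0" using True \<open>V \<noteq> {}\<close> by (metis card_gt_0_iff mult_is_0 neq0_conv le_zero_eq zero_neq_numeral)
  \<comment> \<open>The bound k counts adjacent edges too, so the inclusion suffices; disjoint edges
    are distinct since edges are nonempty.\<close>
  have "odd_pairs c E \<subseteq> (SIGMA e:E. {f \<in> E. f \<noteq> e \<and> odd (card (crossings (c e) (c f)))})"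
    using G by (force simp: odd_pairs_def simple_graph_def)
  then have "card (odd_pairs c E) \<le> card (SIGMA e:E. {f \<in> E. f \<noteq> e \<and> odd (card (crossings (c e) (c f)))})"
    using fE by (intro card_mono finite_SigmaI) auto
  also have "\<dots> = (\<Sum>e\<in>E. card {f \<in> E. f \<noteq> e \<and> odd (card (crossings (c e) (c f)))})"
    using fE by (intro card_SigmaI) auto
  also have "\<dots> \<le> card E * k" using sum_bounded_above[of E _ k] k by simp
  finally have X: "real (card (odd_pairs c E)) \<le> real (card E) * real k"
    by (metis of_nat_le_iff of_nat_mult)
  have "real (card E) ^ 3 \<le> 32 * real (card V) ^ 2 * card (odd_pairs c E)"
    by (rule odd_crossing_lemma[OF G D \<open>V \<noteq> {}\<close> True])
  also have "\<dots> \<le> 32 * real (card V) ^ 2 * (real (card E) * real k)"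
    using X by (intro mult_left_mono) auto
  finally have "real (card E) * real (card E) ^ 2 \<le> real (card E) * (32 * real k * real (card V) ^ 2)"
    by (simp add: power_numeral_reduce algebra_simps)
  then show ?thesis using pos by simp
next
  case False
  then have "real (card E) ^ 2 \<le> (4 * real (card V)) ^ 2" by (intro power_mono) auto
  also have "\<dots> = 16 * 1 * real (card V) ^ 2" by (simp add: power_mult_distrib)
  also have "\<dots> \<le> 32 * real k * real (card V) ^ 2"
    using \<open>k \<ge> 1\<close> by (intro mult_right_mono mult_mono) auto
  finally show ?thesis .
qed

theorem theorem3:
  fixes n k :: nat
  assumes "n \<ge> 1" and "k \<ge> 1"
  shows "real (m_odd k n) \<le> sqrt 32 * sqrt (real k) * real n"
proof -
  have "m_odd k n \<in> {card E | (V :: nat set) E. simple_graph V E \<and> card V = n \<and> k_odd_planar k V E}"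
    unfolding m_odd_def by (intro Max_in m_odd_set)
  then obtain V :: "nat set" and E where E: "m_odd k n = card E" "simple_graph V E" "card V = n" "k_odd_planar k V E"
    by auto
  have "V \<noteq> {}" using E(3) assms(1) by auto
  then have "real (m_odd k n) ^ 2 \<le> 32 * real k * real n ^ 2"
    using k_odd_planar_card_edges[OF E(2,4) _ assms(2)] E by simp
  then have "real (m_odd k n) \<le> sqrt (32 * real k * real n ^ 2)" by (rule real_le_rsqrt)
  then show ?thesis by (simp add: real_sqrt_mult)
qed

end
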